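(* Let $(\mu,k)$ be a spherical profile (i.e. $\sum_i\mu_i(i-2)=k-4$) with $k\ge2$. Then the map sending a path-like square-tiled surface with profile $(\mu,k)$ to its decorated plane tree is a surjection onto the set of decorated plane trees with profile $(\mu,k-2)$. Furthermore, for each decorated plane tree $(T,L)$ with profile $(\mu,k-2)$, its preimage consists of a single orbit under horizontal cylinder shears.
   Context: A square-tiled surface on $[n]$ is a triple $\tau=(\tau_R,\tau_G,\tau_B)$ of involutions of $[n]$ (fixed points allowed) acting transitively; $S(\tau)$ is the surface obtained from $n$ right-angled triangles labelled by $[n]$ (red horizontal leg, blue vertical leg, green hypotenuse) by gluing the colour-$c$ side of triangle $j$ to that of $\tau_c(j)$, a side being folded onto itself by a half-turn when $\tau_c(j)=j$ (a "half-edge"). $S^*(\tau)$ is the dual cubic graph with vertices $[n]$, colour-$c$ edges for transpositions of $\tau_c$ and colour-$c$ half-edges at fixed points. Isomorphism is simultaneous conjugation by a permutation. Profile $(\mu,k)$: $\mu$ is the cycle type of $\tau_R\tau_G\tau_B$, $k$ the total number of fixed points. $\tau$ is path-like if $\langle\tau_G,\tau_B\rangle$ has a single orbit and it is a path in $S^*(\tau)$; then $S(\tau)$ is a sphere. A decorated plane tree is a pair $(T,L)$ with $T$ a tree embedded in the sphere and $L$ a subset of its leaves; it has profile $(\mu,\ell)$ if $|L|=\ell$ and, for each $i$, $\mu_i$ is the number of vertices of $T$ not in $L$ having degree $i$. The decorated plane tree of a path-like $\tau$ is the graph embedded in $S(\tau)$ whose vertices are the vertices of the triangulation $S(\tau)$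 together with one extra vertex at the fold point of each folded red side, whose edges are the (non-folded) red sides and, for each folded red side, the segment from its endpoint to its fold point; $L$ is the set of extra vertices. Horizontal cylinder shears: for $c$ a $\{G,B\}$-component, $\operatorname{Shear}_{c,G,B}(\tau)$ replaces $\tau_G|_c$ by $\tau_B|_c$ and $\tau_B|_c$ by $(\tau_B\tau_G\tau_B)|_c$; $\operatorname{Shear}_{c,B,G}(\tau)$ replaces $\tau_B|_c$ by $\tau_G|_c$ and $\tau_G|_c$ by $(\tau_G\tau_B\tau_G)|_c$; these are mutually inverse. Orbits are taken on isomorphism classes. *)

theory Defs
  imports
    "HOL-Library.Multiset"
    "HOL-Combinatorics.Orbits"
    "Graph_Theory.Bidirected_Digraph"
    "Graph_Theory.Digraph_Component"
begin

section \<open>Square-tiled surfaces\<close>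

datatype colour = Red | Green | Blue

text \<open>A triple of involutions of \<open>[n] = {1..n}\<close> is a function on colours; each involution is
  extended by the identity outside \<open>[n]\<close>. Since the generators are involutions, the orbits of the
  group generated by those with colour in \<open>K\<close> are the reachability classes below.\<close>

type_synonym triple = "colour \<Rightarrow> nat \<Rightarrow> nat"

definition component :: "triple \<Rightarrow> colour set \<Rightarrow> nat \<Rightarrow> nat set" where
  "component \<tau> K j = {i. (j, i) \<in> {(a, \<tau> c a) | a c. c \<in> K}\<^sup>*}"

definition square_tiled :: "nat \<Rightarrow> triple \<Rightarrow> bool" where
  "square_tiled n \<tau> \<longleftrightarrow>
     (\<forall>c. \<tau> c permutes {1..n} \<and> \<tau> c \<circ> \<tau> c = id) \<and>
     (\<forall>j\<in>{1..n}. component \<tau> UNIV j = {1..n})"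

definition surface_iso :: "nat \<Rightarrow> triple \<Rightarrow> triple \<Rightarrow> bool" where
  "surface_iso n \<tau> \<tau>' \<longleftrightarrow> (\<exists>\<pi>. \<pi> permutes {1..n} \<and> (\<forall>c. \<tau>' c = \<pi> \<circ> \<tau> c \<circ> inv \<pi>))"

definition cycle_type :: "nat \<Rightarrow> (nat \<Rightarrow> nat) \<Rightarrow> nat multiset" where
  "cycle_type n f = image_mset card (mset_set (orbit f ` {1..n}))"

definition surface_profile :: "nat \<Rightarrow> triple \<Rightarrow> nat multiset \<Rightarrow> nat \<Rightarrow> bool" where
  "surface_profile n \<tau> \<mu> k \<longleftrightarrow>
     cycle_type n (\<tau> Red \<circ> \<tau> Green \<circ> \<tau> Blue) = \<mu> \<and>
     (\<Sum>c\<in>{Red, Green, Blue}. card {j \<in> {1..n}. \<tau> c j = j}) = k"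

text \<open>The list \<open>p\<close> runs along the path: in the subgraph of the dual graph with colours green and
  blue, consecutive vertices are joined by exactly one edge and other pairs by none. Counting
  edges with multiplicity matters for \<open>n = 2\<close>, where a green and a blue edge with the same ends
  form a cycle. The half-edges at the two ends of the path are fixed points and are not counted
  as edges.\<close>

definition path_like :: "nat \<Rightarrow> triple \<Rightarrow> bool" where
  "path_like n \<tau> \<longleftrightarrow>
     (\<forall>j\<in>{1..n}. component \<tau> {Green, Blue} j = {1..n}) \<and>
     (\<exists>p. distinct p \<and> set p = {1..n} \<and>
        (\<forall>i j. i < j \<and> j < length p \<longrightarrow>
           card {c \<in> {Green, Blue}. \<tau> c (p ! i) = p ! j} = (if j = Suc i then 1 else 0)))"

definition path_like_surfaces :: "nat \<Rightarrow> nat multiset \<Rightarrow> nat \<Rightarrow> triple set" where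
  "path_like_surfaces n \<mu> k =
     {\<tau>. square_tiled n \<tau> \<and> path_like n \<tau> \<and> surface_profile n \<tau> \<mu> k}"

section \<open>Horizontal cylinder shears\<close>

definition shear :: "nat set \<Rightarrow> colour \<Rightarrow> colour \<Rightarrow> triple \<Rightarrow> triple" where
  "shear C x y \<tau> = \<tau>(
     x := (\<lambda>j. if j \<in> C then \<tau> y j else \<tau> x j),
     y := (\<lambda>j. if j \<in> C then \<tau> y (\<tau> x (\<tau> y j)) else \<tau> y j))"

definition horizontal_shear :: "nat \<Rightarrow> triple \<Rightarrow> triple \<Rightarrow> bool" where
  "horizontal_shear n \<tau> \<tau>' \<longleftrightarrow>
     (\<exists>j\<in>{1..n}. let C = component \<tau> {Green, Blue} j in
        \<tau>' = shear C Green Blue \<tau> \<or> \<tau>' = shear C Blue Green \<tau>)"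

text \<open>All triples whose isomorphism class lies in the orbit of the isomorphism class of \<open>\<tau>\<close>. The
  two kinds of shear are mutually inverse, so reachability is symmetric.\<close>

definition shear_orbit :: "nat \<Rightarrow> triple \<Rightarrow> triple set" where
  "shear_orbit n \<tau> = {\<tau>'. (\<lambda>a b. surface_iso n a b \<or> horizontal_shear n a b)\<^sup>*\<^sup>* \<tau> \<tau>'}"

section \<open>Decorated plane trees\<close>

text \<open>An edge is a pair of mutually reverse arcs \<open>a\<close>, \<open>flip T a\<close>. An embedding of a tree in the
  oriented sphere is recorded, up to orientation-preserving homeomorphism, by its rotation system:
  \<open>rot T\<close> sends each arc to the next one counterclockwise among the arcs leaving the same vertex.
  (Every rotation system of a tree has a single face, hence genus zero.)\<close>

record ('v, 'a) decorated_map =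
  graph :: "('v, 'a) pre_digraph"
  flip :: "'a \<Rightarrow> 'a"
  rot :: "'a \<Rightarrow> 'a"
  marked :: "'v set"

text \<open>The constant \<open>tree\<close> of the graph library is not usable for undirected graphs, since there an
  arc followed by its reverse is a cycle. Here a cycle may not use both arcs of an edge.\<close>

definition plane_tree :: "('v, 'a) decorated_map \<Rightarrow> bool" where
  "plane_tree T \<longleftrightarrow>
     fin_digraph (graph T) \<and> bidirected_digraph (graph T) (flip T) \<and>
     connected (graph T) \<and>
     \<not> (\<exists>p. pre_digraph.cycle (graph T) p \<and> (\<forall>a\<in>set p. flip T a \<notin> set p)) \<and>
     rot T permutes arcs (graph T) \<and>
     (\<forall>v\<in>verts (graph T). out_arcs (graph T) v \<noteq> {} \<longrightarrow>
        cyclic_on (rot T) (out_arcs (graph T) v))"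

definition decorated_plane_tree :: "('v, 'a) decorated_map \<Rightarrow> bool" where
  "decorated_plane_tree T \<longleftrightarrow>
     plane_tree T \<and> marked T \<subseteq> {v \<in> verts (graph T). out_degree (graph T) v = 1}"

definition tree_profile :: "('v, 'a) decorated_map \<Rightarrow> nat multiset \<Rightarrow> nat \<Rightarrow> bool" where
  "tree_profile T \<mu> l \<longleftrightarrow>
     card (marked T) = l \<and>
     (\<forall>i. count \<mu> i = card {v \<in> verts (graph T) - marked T. out_degree (graph T) v = i})"

definition tree_iso :: "('v, 'a) decorated_map \<Rightarrow> ('w, 'b) decorated_map \<Rightarrow> bool" where
  "tree_iso T T' \<longleftrightarrow>
     (\<exists>f g. bij_betw f (verts (graph T)) (verts (graph T')) \<and>
        bij_betw g (arcs (graph T)) (arcs (graph T')) \<and>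
        f ` marked T = marked T' \<and>
        (\<forall>a\<in>arcs (graph T).
           tail (graph T') (g a) = f (tail (graph T) a) \<and>
           head (graph T') (g a) = f (head (graph T) a) \<and>
           flip T' (g a) = g (flip T a) \<and>
           rot T' (g a) = g (rot T a)))"

section \<open>The decorated plane tree of a surface\<close>

text \<open>Every triangle is the one with corners \<open>(0,0)\<close>, \<open>(1,0)\<close>, \<open>(0,1)\<close>, or its image under a
  half-turn, so that going counterclockwise along the boundary one meets the red, the green and the
  blue side. The pair \<open>(j, c)\<close> stands for the corner of triangle \<open>j\<close> at which its side of colour \<open>c\<close>
  starts in this direction; this side ends at the corner \<open>(j, next_colour c)\<close>. Gluing by a half-turn
  identifies the start of side \<open>c\<close> of \<open>j\<close> with the end of side \<open>c\<close> of \<open>\<tau> c j\<close>, also for a folded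
  side.\<close>

fun next_colour :: "colour \<Rightarrow> colour" where
  "next_colour Red = Green"
| "next_colour Green = Blue"
| "next_colour Blue = Red"

definition corner_gluing :: "nat \<Rightarrow> triple \<Rightarrow> ((nat \<times> colour) \<times> (nat \<times> colour)) set" where
  "corner_gluing n \<tau> = {((j, c), (\<tau> c j, next_colour c)) | j c. j \<in> {1..n}}"

definition surface_vertex :: "nat \<Rightarrow> triple \<Rightarrow> nat \<times> colour \<Rightarrow> (nat \<times> colour) set" where
  "surface_vertex n \<tau> x = {y. (x, y) \<in> (corner_gluing n \<tau> \<union> (corner_gluing n \<tau>)\<inverse>)\<^sup>*}"

datatype tree_vertex = Vertex "(nat \<times> colour) set" | Fold nat

text \<open>\<open>Leg j\<close> is the red side of triangle \<open>j\<close>, or its half up to the fold point if it is folded,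
  leaving from the corner \<open>(j, Red)\<close>; \<open>Stub j\<close> is the folded half leaving from the fold point. If
  the side is not folded, the same edge traversed backwards is \<open>Leg (\<tau> Red j)\<close>.\<close>

datatype tree_arc = Leg nat | Stub nat

definition folded :: "nat \<Rightarrow> triple \<Rightarrow> nat set" where
  "folded n \<tau> = {j \<in> {1..n}. \<tau> Red j = j}"

definition red_graph :: "nat \<Rightarrow> triple \<Rightarrow> (tree_vertex, tree_arc) pre_digraph" where
  "red_graph n \<tau> =
    \<lparr> verts = (\<lambda>x. Vertex (surface_vertex n \<tau> x)) ` ({1..n} \<times> UNIV) \<union> Fold ` folded n \<tau>,
      arcs = Leg ` {1..n} \<union> Stub ` folded n \<tau>,
      tail = (\<lambda>a. case a of
                Leg j \<Rightarrow> Vertex (surface_vertex n \<tau> (j, Red))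
              | Stub j \<Rightarrow> Fold j),
      head = (\<lambda>a. case a of
                Leg j \<Rightarrow> if j \<in> folded n \<tau> then Fold j
                         else Vertex (surface_vertex n \<tau> (j, next_colour Red))
              | Stub j \<Rightarrow> Vertex (surface_vertex n \<tau> (j, Red))) \<rparr>"

text \<open>Turning counterclockwise about a vertex of the triangulation from \<open>Leg j\<close>, one crosses
  triangle \<open>j\<close> and its blue side, then triangle \<open>\<tau> Blue j\<close> and its green side, then triangle
  \<open>\<tau> Green (\<tau> Blue j)\<close>, and so reaches the red side of the latter at its end corner, that is, at the
  start corner of the red side of \<open>\<tau> Red (\<tau> Green (\<tau> Blue j))\<close>.\<close>

definition tree_of :: "nat \<Rightarrow> triple \<Rightarrow> (tree_vertex, tree_arc) decorated_map" where
  "tree_of n \<tau> =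
    \<lparr> graph = red_graph n \<tau>,
      flip = (\<lambda>a. if a \<in> arcs (red_graph n \<tau>)
                  then (case a of
                          Leg j \<Rightarrow> if j \<in> folded n \<tau> then Stub j else Leg (\<tau> Red j)
                        | Stub j \<Rightarrow> Leg j)
                  else a),
      rot = (\<lambda>a. case a of
                   Leg j \<Rightarrow> Leg (\<tau> Red (\<tau> Green (\<tau> Blue j)))
                 | Stub j \<Rightarrow> Stub j),
      marked = Fold ` folded n \<tau> \<rparr>"

end

theory Submission
  imports Defs
begin

text \<open>
  Two involutions \<open>\<tau> Green\<close>, \<open>\<tau> Blue\<close> form a path exactly when their product \<open>c\<close> is an \<open>n\<close>-cycle.
  Since \<open>c\<close> is \<open>\<tau> Red\<close> times the rotation about the vertices, this says that the red graph has a single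
  face, so the spherical profile makes it a tree by an Euler characteristic count. Conversely, the walk
  around a plane tree is a single cycle; writing it as a product of two reflections gives a path-like
  surface with that tree. Two surfaces with the same tree agree, after relabelling, in \<open>\<tau> Red\<close> and
  \<open>c\<close>, so their blue involutions differ by a power of \<open>c\<close>, and a shear is multiplication by \<open>c\<close>.
\<close>

section \<open>Paths and cyclic products of involutions\<close>

text \<open>The obstacle is that a folded red side belongs to one triangle but gives two arcs,
  \<open>Leg\<close> and \<open>Stub\<close>. Discarding the arcs that leave marked leaves restores
  a bijection between triangles and arcs; such a bijection, if compatible with the structure, is a
  \<open>labelling\<close>. Under it \<open>rot\<close> becomes
  \<open>\<tau> Red \<circ> \<tau> Green \<circ> \<tau> Blue\<close> and reversal of arcs becomes
  \<open>\<tau> Red\<close>, an arc into a marked leaf being a fixed point. Vertices need not be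
  carried along, since they are orbits of the rotation. Tree isomorphisms are therefore traded for
  labellings in both directions. A labelling determines the cycle
  \<open>\<tau> Green \<circ> \<tau> Blue\<close> but not its two factors. These are reflections of
  the cycle, fixed by a single value, so shearing in one direction, which runs through all powers of
  the finite cycle, reaches every choice. The shift from \<open>k\<close> to \<open>k - 2\<close>
  comes from the ends of the path: they carry exactly two green or blue half-edges, and all other
  half-edges are folded red sides.\<close>

declare One_nat_def [simp del]

text \<open>The walk along the green-blue path from an end \<open>p\<close> whose
  \<open>y\<close>-side will be a half-edge; this is why the first step, at index 0, uses
  \<open>x\<close>.\<close>

primrec zigzag :: "('a \<Rightarrow> 'a) \<Rightarrow> ('a \<Rightarrow> 'a) \<Rightarrow> 'a \<Rightarrow> nat \<Rightarrow> 'a" where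
  "zigzag x y p 0 = p"
| "zigzag x y p (Suc i) = (if even i then x else y) (zigzag x y p i)"

context
  fixes x y :: "'a \<Rightarrow> 'a" and p :: 'a and S :: "'a set"
  assumes x_invol: "\<And>a. x (x a) = a" and y_invol: "\<And>a. y (y a) = a"
    and fixed: "y p = p" and finite_S: "finite S" and p_in: "p \<in> S"
    and x_in: "\<And>a. a \<in> S \<Longrightarrow> x a \<in> S" and y_in: "\<And>a. a \<in> S \<Longrightarrow> y a \<in> S"
    and minimal: "\<And>U. p \<in> U \<Longrightarrow> U \<subseteq> S \<Longrightarrow> (\<And>a. a \<in> U \<Longrightarrow> x a \<in> U \<and> y a \<in> U) \<Longrightarrow> U = S"
begin

abbreviation (input) "Z \<equiv> zigzag x y p"

lemma x_zigzag: "x (Z i) = (if even i then Z (Suc i) else Z (i - 1))"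
  by (cases i) (auto simp: x_invol)

text \<open>At \<open>i = 0\<close> the truncated difference \<open>0 - 1 = 0\<close> encodes that
  \<open>y\<close> fixes \<open>p\<close>.\<close>

lemma y_zigzag: "y (Z i) = (if odd i then Z (Suc i) else Z (i - 1))"
  by (cases i) (auto simp: y_invol fixed)

lemma zigzag_in: "Z i \<in> S"
  by (induction i) (auto simp: p_in x_in y_in)

text \<open>Consider the first repetition \<open>Z N = Z j\<close>. Undoing the last step makes
  \<open>Z (N - 1)\<close> equal to a neighbour of \<open>Z j\<close> on the walk, which would be an
  earlier repetition unless \<open>j = N - 1\<close>. So the walk does not close up but is reflected
  at a second fixed point; the points visited are then closed under both involutions, hence
  everything.\<close>

lemma zigzag_exhausts:
  obtains N where "N > 0" "inj_on Z {..<N}" "Z ` {..<N} = S" "Z N = Z (N - 1)"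
proof -
  have "\<exists>N. Z N \<in> Z ` {..<N}"
  proof (rule ccontr)
    assume "\<nexists>N. Z N \<in> Z ` {..<N}"
    then have "inj Z"
      by (intro linorder_injI) (auto simp: image_iff, metis lessThan_iff)
    then show False
      using finite_S zigzag_in by (metis finite_subset image_subsetI range_inj_infinite)
  qed
  define N where "N = (LEAST N. Z N \<in> Z ` {..<N})"
  have N: "Z N \<in> Z ` {..<N}"
    unfolding N_def using \<open>\<exists>N. _\<close> by (rule LeastI_ex)
  have least: "Z i \<notin> Z ` {..<i}" if "i < N" for i
    using that not_less_Least unfolding N_def by blast
  have neq: "Z i \<noteq> Z j" if "i < j" "j < N" for i j
    using least[OF that(2)] that(1) by (metis image_eqI lessThan_iff)
  obtain M where M: "N = Suc M"
    using N by (cases N) auto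
  obtain j where j: "j < N" "Z N = Z j"
    using N by auto
  have "Z N = Z M"
  proof (cases "j = M")
    case False
    then have "j < M" using j M by simp
    have "Z M = (if even M then x else y) (Z j)"
      using j M by (auto simp: x_invol y_invol split: if_splits) (metis x_invol, metis y_invol)
    also have "\<dots> = (if even M = even j then Z (Suc j) else Z (j - 1))"
      by (auto simp: x_zigzag y_zigzag simp del: zigzag.simps)
    finally have eq: "Z M = (if even M = even j then Z (Suc j) else Z (j - 1))" .
    moreover have "Z (j - 1) \<noteq> Z M" using neq[of "j - 1" M] \<open>j < M\<close> M by simp
    moreover have "Z (Suc j) \<noteq> Z M" if "even M = even j"
    proof -
      \<comment> \<open>Equal parity of \<open>j\<close> and \<open>M\<close> excludes
        \<open>M = Suc j\<close>, the only way in which the neighbour \<open>Z (Suc j)\<close> could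
        be \<open>Z M\<close> itself.\<close>
      have "Suc j \<noteq> M" using that by auto
      then show ?thesis using neq[of "Suc j" M] \<open>j < M\<close> M by linarith
    qed
    ultimately show ?thesis by (auto split: if_splits)
  qed (use j in simp)
  have "Z ` {..<N} = S"
  proof (rule minimal)
    show "p \<in> Z ` {..<N}" using M by (auto intro!: image_eqI[of _ _ 0])
    show "Z ` {..<N} \<subseteq> S" using zigzag_in by auto
    have "Z (Suc i) \<in> Z ` {..<N}" "Z (i - 1) \<in> Z ` {..<N}" if "i < N" for i
    proof -
      show "Z (Suc i) \<in> Z ` {..<N}"
        using that N by (cases "Suc i = N") (auto simp del: zigzag.simps)
      show "Z (i - 1) \<in> Z ` {..<N}" using that by (intro imageI) auto
    qed
    then show "x a \<in> Z ` {..<N} \<and> y a \<in> Z ` {..<N}" if "a \<in> Z ` {..<N}" for a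
      using that by (auto simp: x_zigzag y_zigzag simp del: zigzag.simps)
  qed
  moreover have "inj_on Z {..<N}"
    by (rule linorder_inj_onI) (auto simp: neq)
  ultimately show ?thesis
    using that[of N] M \<open>Z N = Z M\<close> by simp
qed

text \<open>The zigzag, cut before its first repetition, is the path. Parity of the position decides
  which involution supplies the edge, so no pair is joined by both.\<close>

lemma path_of_involutions:
  obtains q where "distinct q" "set q = S"
    "\<And>i j. i < j \<Longrightarrow> j < length q \<Longrightarrow> x (q ! i) = q ! j \<longleftrightarrow> j = Suc i \<and> even i"
    "\<And>i j. i < j \<Longrightarrow> j < length q \<Longrightarrow> y (q ! i) = q ! j \<longleftrightarrow> j = Suc i \<and> odd i"
proof -
  obtain N where N: "N > 0" "inj_on Z {..<N}" "Z ` {..<N} = S" "Z N = Z (N - 1)"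
    by (rule zigzag_exhausts)
  have eq: "Z i = Z j \<longleftrightarrow> i = j" if "i < N" "j < N" for i j
    using N(2) that by (auto simp: inj_on_def)
  show ?thesis
  proof (rule that[of "map Z [0..<N]"])
    show "distinct (map Z [0..<N])" using N(2) by (simp add: distinct_map lessThan_atLeast0)
    show "set (map Z [0..<N]) = S" using N(3) by (simp add: lessThan_atLeast0)
    fix i j assume ij: "i < j" "j < length (map Z [0..<N])"
    then have "Z (Suc i) = Z j \<longleftrightarrow> Suc i = j" "Z (i - 1) \<noteq> Z j"
      using eq[of "Suc i" j] eq[of "i - 1" j] by auto
    then show "x (map Z [0..<N] ! i) = map Z [0..<N] ! j \<longleftrightarrow> j = Suc i \<and> even i"
      "y (map Z [0..<N] ! i) = map Z [0..<N] ! j \<longleftrightarrow> j = Suc i \<and> odd i"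
      using ij by (auto simp: x_zigzag y_zigzag simp del: zigzag.simps)
  qed
qed

text \<open>The fixed points are the two ends of the path: \<open>p\<close> is fixed by
  \<open>y\<close>, the last point by \<open>x\<close> or \<open>y\<close> according to the parity
  of \<open>N\<close>. For \<open>N = 1\<close> both half-edges sit at \<open>p\<close>, one of each
  colour, which is why the two sets are counted separately.\<close>

lemma card_fixed_points_involutions:
  "card {a \<in> S. x a = a} + card {a \<in> S. y a = a} = 2"
proof -
  obtain N where N: "N > 0" "inj_on Z {..<N}" "Z ` {..<N} = S" "Z N = Z (N - 1)"
    by (rule zigzag_exhausts)
  have eq: "Z i = Z j \<longleftrightarrow> i = j" if "i < N" "j < N" for i j
    using N(2) that by (auto simp: inj_on_def)
  have Suc: "Z (Suc i) = Z i \<longleftrightarrow> Suc i = N" if "i < N" for i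
    using eq[of "Suc i" i] that N(4) by (cases "Suc i = N") (auto simp del: zigzag.simps)
  have pred: "Z (i - 1) = Z i \<longleftrightarrow> i = 0" if "i < N" for i
    using eq[of "i - 1" i] that by (auto simp del: zigzag.simps)
  have "{a \<in> S. x a = a} = Z ` {i. i < N \<and> x (Z i) = Z i}"
    unfolding N(3)[symmetric] by auto
  also have "{i. i < N \<and> x (Z i) = Z i} = (if even N then {} else {N - 1})"
  proof -
    have "x (Z i) = Z i \<longleftrightarrow> Suc i = N \<and> even i" if "i < N" for i
      using Suc[OF that] pred[OF that] unfolding x_zigzag
      by (cases "even i") (auto simp del: zigzag.simps)
    then have "{i. i < N \<and> x (Z i) = Z i} = {i. i < N \<and> Suc i = N \<and> even i}" by blast
    also have "\<dots> = (if even N then {} else {N - 1})" using N(1) by auto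
    finally show ?thesis .
  qed
  finally have fix_x: "card {a \<in> S. x a = a} = (if even N then 0 else 1)"
    by simp
  have "{a \<in> S. y a = a} = Z ` {i. i < N \<and> y (Z i) = Z i}"
    unfolding N(3)[symmetric] by auto
  also have "{i. i < N \<and> y (Z i) = Z i} = (if even N then {0, N - 1} else {0})"
  proof -
    have "y (Z i) = Z i \<longleftrightarrow> i = 0 \<or> Suc i = N \<and> odd i" if "i < N" for i
      using Suc[OF that] pred[OF that] unfolding y_zigzag
      by (cases "even i") (auto simp del: zigzag.simps)
    then have "{i. i < N \<and> y (Z i) = Z i} = {i. i < N \<and> (i = 0 \<or> Suc i = N \<and> odd i)}"
      by blast
    also have "\<dots> = (if even N then {0, N - 1} else {0})" using N(1) by auto
    finally show ?thesis .
  qed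
  finally have "card {a \<in> S. y a = a} = card (Z ` (if even N then {0, N - 1} else {0}))"
    by simp
  also have "\<dots> = card (if even N then {0, N - 1} else {0})"
    by (rule card_image, rule inj_on_subset[OF N(2)]) (use N(1) in auto)
  also have "\<dots> = (if even N then 2 else 1)"
    using N(1) by (auto simp: card_insert_if)
  finally show ?thesis using fix_x by simp
qed

end

section \<open>Products of two involutions with a fixed point\<close>

lemma orbit_comp_involutions_swap:
  assumes "x permutes S" "y permutes S" "finite S" and inv: "\<And>a. x (x a) = a" "\<And>a. y (y a) = a"
  shows "orbit (x \<circ> y) a = orbit (y \<circ> x) a"
proof -
  have perm: "permutation (x \<circ> y)"
    using assms(1-3) permutation_permutes permutes_compose by blast
  have "inv (x \<circ> y) = y \<circ> x"
    by (rule inv_unique_comp) (auto simp: fun_eq_iff inv)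
  then show ?thesis using orbit_inv_eq[OF perm, of a] by simp
qed

text \<open>The rotation \<open>x \<circ> y\<close> of a dihedral action has at most two orbits on a
  transitive set, exchanged by \<open>y\<close>; a fixed point of \<open>y\<close> merges them.
  Concretely, the points of the orbit of \<open>p\<close> whose \<open>y\<close>-image also lies in
  it contain \<open>p\<close> and are closed under \<open>x\<close> and \<open>y\<close>.\<close>

lemma cyclic_on_comp_involutions:
  assumes S: "x permutes S" "y permutes S" "finite S"
    and inv: "\<And>a. x (x a) = a" "\<And>a. y (y a) = a"
    and p: "p \<in> S" "y p = p"
    and minimal: "\<And>U. p \<in> U \<Longrightarrow> (\<And>a. a \<in> U \<Longrightarrow> x a \<in> U \<and> y a \<in> U) \<Longrightarrow> S \<subseteq> U"
  shows "cyclic_on (x \<circ> y) S" "cyclic_on (y \<circ> x) S"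
proof -
  define f where "f = x \<circ> y"
  have f: "f permutes S" using S permutes_compose unfolding f_def by blast
  then have perm: "permutation f" using S(3) permutation_permutes by blast
  have swap: "orbit f a = orbit (y \<circ> x) a" for a
    unfolding f_def by (rule orbit_comp_involutions_swap[OF S inv])
  have "S \<subseteq> {a \<in> orbit f p. y a \<in> orbit f p}"
  proof (rule minimal)
    show "p \<in> {a \<in> orbit f p. y a \<in> orbit f p}"
      using p permutation_self_in_orbit[OF perm] by simp
    fix a assume a: "a \<in> {a \<in> orbit f p. y a \<in> orbit f p}"
    then have "f (y a) \<in> orbit f p" by (simp add: orbit.step)
    moreover have "y (x a) \<in> orbit f p"
      using a orbit.step[of a "y \<circ> x" p] by (simp add: swap)
    ultimately show "x a \<in> {a \<in> orbit f p. y a \<in> orbit f p} \<and>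
        y a \<in> {a \<in> orbit f p. y a \<in> orbit f p}"
      using a by (simp add: f_def inv)
  qed
  moreover have "orbit f p \<subseteq> S" using f p(1) by (rule permutes_orbit_subset)
  ultimately have "S = orbit f p" by blast
  then show "cyclic_on (x \<circ> y) S" "cyclic_on (y \<circ> x) S"
    using p(1) swap[of p] unfolding f_def cyclic_on_def by blast+
qed

text \<open>Conjugation by \<open>y\<close> inverts \<open>f = x \<circ> y\<close>, with
  \<open>g\<close> as the inverse. If \<open>y b = f^m b\<close>, then \<open>y\<close> sends
  \<open>f^i b\<close> to \<open>f^(m-i) b\<close> and \<open>x\<close> sends it to
  \<open>f^(m+1-i) b\<close>. So \<open>y\<close> has a fixed point at \<open>i = m/2\<close> for
  even \<open>m\<close>, and \<open>x\<close> at \<open>i = (m+1)/2\<close> for odd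
  \<open>m\<close>.\<close>

lemma fixed_point_of_cyclic_comp:
  assumes inv: "\<And>a. x (x a) = a" "\<And>a. y (y a) = a"
    and S: "y permutes S" and cyclic: "cyclic_on (x \<circ> y) S"
  obtains p where "p \<in> S" "x p = p \<or> y p = p"
proof -
  define f g where "f = x \<circ> y" and "g = y \<circ> x"
  have y_f: "y ((f ^^ k) a) = (g ^^ k) (y a)" for k a
    by (induction k) (simp_all add: f_def g_def)
  have "g (f a) = a" for a by (simp add: f_def g_def inv)
  then have g_f: "(g ^^ k) ((f ^^ k) a) = a" for k a
    by (induction k arbitrary: a) (simp_all add: funpow_swap1)
  obtain b where b: "b \<in> S" "S = orbit f b"
    using cyclic by (auto simp: cyclic_on_def f_def)
  then have "y b \<in> orbit f b" using S by (metis permutes_in_image)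
  then obtain m where m: "y b = (f ^^ m) b" by (auto simp: orbit_altdef)
  have in_S: "(f ^^ r) b \<in> S" for r
    using cyclic_on_funpow_in[OF cyclic b(1)] by (simp add: f_def)
  show ?thesis
  proof (cases "even m")
    case True
    then obtain r where "m = r + r" by (metis evenE mult_2)
    then have "y ((f ^^ r) b) = (f ^^ r) b"
      by (simp add: y_f m funpow_add g_f)
    then show ?thesis using that in_S by blast
  next
    case False
    then obtain r where r: "m = r + Suc r" by (metis oddE mult_2 add_Suc_right Suc_eq_plus1)
    have "x ((f ^^ Suc r) b) = f (y ((f ^^ Suc r) b))" by (simp add: f_def inv)
    also have "\<dots> = f (g ((g ^^ r) ((f ^^ m) b)))" unfolding y_f m by simp
    also have "\<dots> = (f ^^ Suc r) b"
      unfolding r funpow_add comp_apply g_f by (simp add: f_def g_def inv)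
    finally show ?thesis using that in_S by blast
  qed
qed

section \<open>Path-like surfaces as triples with a cyclic green-blue product\<close>

definition cyclic_triple :: "nat \<Rightarrow> triple \<Rightarrow> bool" where
  "cyclic_triple n \<tau> \<longleftrightarrow> (\<forall>c. \<tau> c permutes {1..n} \<and> \<tau> c \<circ> \<tau> c = id) \<and>
     cyclic_on (\<tau> Green \<circ> \<tau> Blue) {1..n}"

lemma component_closed:
  "a \<in> component \<tau> K j \<Longrightarrow> c \<in> K \<Longrightarrow> \<tau> c a \<in> component \<tau> K j"
  unfolding component_def by (auto intro: rtrancl_into_rtrancl)

lemma component_self: "j \<in> component \<tau> K j"
  unfolding component_def by simp

lemma component_subset:
  assumes "j \<in> U" "\<And>a c. a \<in> U \<Longrightarrow> c \<in> K \<Longrightarrow> \<tau> c a \<in> U"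
  shows "component \<tau> K j \<subseteq> U"
proof
  fix i assume "i \<in> component \<tau> K j"
  then have "(j, i) \<in> {(a, \<tau> c a) | a c. c \<in> K}\<^sup>*" by (simp add: component_def)
  then show "i \<in> U" by induction (use assms in auto)
qed

context
  fixes n :: nat and \<tau> :: triple
  assumes cyc: "cyclic_triple n \<tau>"
begin

lemma cyclic_triple_permutes: "\<tau> c permutes {1..n}"
  using cyc by (simp add: cyclic_triple_def)

lemma cyclic_triple_invol: "\<tau> c (\<tau> c a) = a"
  using cyc unfolding cyclic_triple_def by (metis comp_apply id_apply)

lemma cyclic_triple_in: "\<tau> c a \<in> {1..n} \<longleftrightarrow> a \<in> {1..n}"
  using cyclic_triple_permutes by (rule permutes_in_image)

lemma cyclic_triple_component:
  assumes "{Green, Blue} \<subseteq> K" "j \<in> {1..n}"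
  shows "component \<tau> K j = {1..n}"
proof
  show "component \<tau> K j \<subseteq> {1..n}"
    using assms(2) cyclic_triple_in by (intro component_subset) auto
  have "orbit (\<tau> Green \<circ> \<tau> Blue) j \<subseteq> component \<tau> K j"
  proof
    fix i assume "i \<in> orbit (\<tau> Green \<circ> \<tau> Blue) j"
    then show "i \<in> component \<tau> K j"
      using assms(1) by induction (auto intro!: component_closed component_self)
  qed
  moreover have "orbit (\<tau> Green \<circ> \<tau> Blue) j = {1..n}"
    using cyc unfolding cyclic_triple_def by (intro orbit_cyclic_eq3 assms(2)) simp
  ultimately show "{1..n} \<subseteq> component \<tau> K j" by simp
qed

text \<open>Neither colour can be prescribed: on a path with an even number of vertices both end
  half-edges have the same colour. Naming it \<open>y\<close> lets the zigzag lemmas apply to either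
  case.\<close>

lemma cyclic_triple_colours:
  obtains x y p where "{x, y} = {Green, Blue}" "p \<in> {1..n}" "\<tau> y p = p"
proof -
  have "cyclic_on (\<tau> Green \<circ> \<tau> Blue) {1..n}" using cyc by (simp add: cyclic_triple_def)
  then obtain p where "p \<in> {1..n}" "\<tau> Green p = p \<or> \<tau> Blue p = p"
    using fixed_point_of_cyclic_comp[of "\<tau> Green" "\<tau> Blue" "{1..n}"]
      cyclic_triple_invol cyclic_triple_permutes by metis
  then show ?thesis using that[of Green Blue] that[of Blue Green] by auto
qed

lemma cyclic_triple_minimal:
  assumes "{x, y} = {Green, Blue}" "p \<in> U" "U \<subseteq> {1..n}"
    "\<And>a. a \<in> U \<Longrightarrow> \<tau> x a \<in> U \<and> \<tau> y a \<in> U"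
  shows "U = {1..n}"
proof -
  have "component \<tau> {Green, Blue} p \<subseteq> U"
    using assms by (intro component_subset) (auto simp: doubleton_eq_iff)
  then show ?thesis
    using cyclic_triple_component[of "{Green, Blue}" p] assms(2,3) by blast
qed

lemma cyclic_triple_path_like: "path_like n \<tau>"
proof -
  obtain x y p where xy: "{x, y} = {Green, Blue}" and p: "p \<in> {1..n}" "\<tau> y p = p"
    by (rule cyclic_triple_colours)
  obtain q where q: "distinct q" "set q = {1..n}"
    "\<And>i j. i < j \<Longrightarrow> j < length q \<Longrightarrow> \<tau> x (q ! i) = q ! j \<longleftrightarrow> j = Suc i \<and> even i"
    "\<And>i j. i < j \<Longrightarrow> j < length q \<Longrightarrow> \<tau> y (q ! i) = q ! j \<longleftrightarrow> j = Suc i \<and> odd i"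
    by (rule path_of_involutions[of "\<tau> x" "\<tau> y" p "{1..n}"])
       (use p xy cyclic_triple_minimal in \<open>auto simp: cyclic_triple_invol cyclic_triple_in
          simp del: atLeastAtMost_iff\<close>)
  have "card {c \<in> {Green, Blue}. \<tau> c (q ! i) = q ! j} = (if j = Suc i then 1 else 0)"
    if ij: "i < j" "j < length q" for i j
  proof -
    have "{c \<in> {Green, Blue}. \<tau> c (q ! i) = q ! j} =
        (if j = Suc i then {if even i then x else y} else {})"
      unfolding xy[symmetric] using q(3,4)[OF ij] xy by (auto simp: doubleton_eq_iff)
    then show ?thesis by simp
  qed
  then show ?thesis
    unfolding path_like_def using q(1,2) cyclic_triple_component by blast
qed

lemma cyclic_triple_card_fixed:
  "card {j \<in> {1..n}. \<tau> Green j = j} + card {j \<in> {1..n}. \<tau> Blue j = j} = 2"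
proof -
  obtain x y p where xy: "{x, y} = {Green, Blue}" and p: "p \<in> {1..n}" "\<tau> y p = p"
    by (rule cyclic_triple_colours)
  have "card {j \<in> {1..n}. \<tau> x j = j} + card {j \<in> {1..n}. \<tau> y j = j} = 2"
    by (rule card_fixed_points_involutions[of "\<tau> x" "\<tau> y" p "{1..n}"])
       (use p xy cyclic_triple_minimal in \<open>auto simp: cyclic_triple_invol cyclic_triple_in
          simp del: atLeastAtMost_iff\<close>)
  then show ?thesis using xy by (auto simp: doubleton_eq_iff)
qed

end

text \<open>The first vertex of the path carries a half-edge: if green and blue both moved it, both
  would lead to the second vertex, a double edge forbidden by the count 1. With this fixed point and
  transitivity the product is a single cycle.\<close>

lemma path_like_cyclic:
  assumes "square_tiled n \<tau>" "path_like n \<tau>" "n \<ge> 1"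
  shows "cyclic_triple n \<tau>"
proof -
  have \<tau>: "\<tau> c permutes {1..n} \<and> \<tau> c \<circ> \<tau> c = id" for c
    using assms(1) by (simp add: square_tiled_def)
  then have inv: "\<tau> c (\<tau> c a) = a" for c a by (metis comp_apply id_apply)
  obtain q where q: "distinct q" "set q = {1..n}"
    "\<And>i j. i < j \<Longrightarrow> j < length q \<Longrightarrow>
           card {c \<in> {Green, Blue}. \<tau> c (q ! i) = q ! j} = (if j = Suc i then 1 else 0)"
    using assms(2) unfolding path_like_def by blast
  have len: "length q > 0" using q(2) assms(3) by auto
  define p where "p = q ! 0"
  have p: "p \<in> {1..n}" using len q(2) unfolding p_def by (metis nth_mem)
  have fixed: "\<tau> Green p = p \<or> \<tau> Blue p = p"
  proof (rule ccontr)
    assume moved: "\<not> (\<tau> Green p = p \<or> \<tau> Blue p = p)"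
    have next_q: "1 < length q \<and> \<tau> c p = q ! 1" if c: "c \<in> {Green, Blue}" for c
    proof -
      have "\<tau> c p \<in> set q" using \<tau>[of c] p q(2) by (metis permutes_in_image)
      then obtain j where j: "j < length q" "\<tau> c p = q ! j" by (metis in_set_conv_nth)
      have "j > 0" using moved c j(2) unfolding p_def by (cases "j = 0") auto
      have "c \<in> {c \<in> {Green, Blue}. \<tau> c (q ! 0) = q ! j}" using c j unfolding p_def by simp
      moreover have "finite {c \<in> {Green, Blue}. \<tau> c (q ! 0) = q ! j}" by simp
      ultimately have "card {c \<in> {Green, Blue}. \<tau> c (q ! 0) = q ! j} \<noteq> 0"
        by (metis card_0_eq empty_iff)
      then show ?thesis using q(3)[OF \<open>j > 0\<close> j(1)] j by (auto simp: One_nat_def split: if_splits)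
    qed
    then have "{c \<in> {Green, Blue}. \<tau> c (q ! 0) = q ! 1} = {Green, Blue}"
      unfolding p_def by auto
    then show False using q(3)[of 0 1] next_q[of Green] by simp
  qed
  have minimal: "{1..n} \<subseteq> U"
    if "p \<in> U" "\<And>a. a \<in> U \<Longrightarrow> \<tau> Green a \<in> U \<and> \<tau> Blue a \<in> U" for U
  proof -
    have "component \<tau> {Green, Blue} p \<subseteq> U" using that by (intro component_subset) auto
    then show ?thesis using assms(2) p unfolding path_like_def by blast
  qed
  have perm: "\<tau> c permutes {1..n}" for c using \<tau> by blast
  have "cyclic_on (\<tau> Green \<circ> \<tau> Blue) {1..n}"
  proof (cases "\<tau> Blue p = p")
    case True
    show ?thesis
      by (rule cyclic_on_comp_involutions(1)[OF perm perm _ inv inv p True minimal]) auto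
  next
    case False
    then have "\<tau> Green p = p" using fixed by blast
    show ?thesis
      by (rule cyclic_on_comp_involutions(2)[OF perm perm _ inv inv p \<open>\<tau> Green p = p\<close> minimal]) auto
  qed
  then show ?thesis using \<tau> by (simp add: cyclic_triple_def)
qed

text \<open>Of the \<open>k\<close> half-edges, the ends of the path use up two, so the red ones
  number \<open>k - 2\<close>; \<open>k \<ge> 2\<close> makes the truncated subtraction
  exact.\<close>

lemma path_like_surfaces_iff:
  assumes "n \<ge> 1" "k \<ge> 2"
  shows "\<tau> \<in> path_like_surfaces n \<mu> k \<longleftrightarrow> cyclic_triple n \<tau> \<and>
    cycle_type n (\<tau> Red \<circ> \<tau> Green \<circ> \<tau> Blue) = \<mu> \<and> card (folded n \<tau>) = k - 2"
proof -
  have "square_tiled n \<tau> \<and> path_like n \<tau>" if "cyclic_triple n \<tau>"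
    unfolding square_tiled_def
    using that cyclic_triple_path_like[OF that] cyclic_triple_component[OF that, of UNIV]
    by (simp add: cyclic_triple_def)
  then have "square_tiled n \<tau> \<and> path_like n \<tau> \<longleftrightarrow> cyclic_triple n \<tau>"
    using path_like_cyclic[OF _ _ assms(1)] by blast
  moreover have "surface_profile n \<tau> \<mu> k \<longleftrightarrow>
      cycle_type n (\<tau> Red \<circ> \<tau> Green \<circ> \<tau> Blue) = \<mu> \<and> card (folded n \<tau>) = k - 2"
    if "cyclic_triple n \<tau>"
  proof -
    have "(\<Sum>c\<in>{Red, Green, Blue}. card {j \<in> {1..n}. \<tau> c j = j}) = card (folded n \<tau>) + 2"
      using cyclic_triple_card_fixed[OF that] by (simp add: folded_def)
    then show ?thesis
      unfolding surface_profile_def using assms(2) by linarith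
  qed
  ultimately show ?thesis
    unfolding path_like_surfaces_def by blast
qed

section \<open>Plane trees\<close>

context bidirected_digraph
begin

lemma connected_iff_reachable:
  "connected G \<longleftrightarrow> verts G \<noteq> {} \<and> (\<forall>u\<in>verts G. \<forall>v\<in>verts G. u \<rightarrow>\<^sup>*\<^bsub>G\<^esub> v)"
  by (simp add: connected_def strongly_connected_def reachable_mk_symmetric_eq[OF sym_arcs])

lemma connected_induct:
  assumes "connected G" "u \<in> verts G" "v \<in> verts G" "P u"
    and step: "\<And>a. a \<in> arcs G \<Longrightarrow> P (tail G a) \<Longrightarrow> P (head G a)"
  shows "P v"
proof -
  have "u \<rightarrow>\<^sup>*\<^bsub>G\<^esub> v" using assms(1-3) by (auto simp: connected_iff_reachable)
  then show ?thesis
    by (induction rule: reachable_induct) (use assms(4) step in \<open>auto simp: arcs_ends_conv\<close>)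
qed

text \<open>Continuation without backtracking. The later arc stands first in the pair, so that
  well-founded induction at \<open>a\<close> supplies the hypothesis for the arcs beyond
  \<open>a\<close>, that is, for the subtree that \<open>a\<close> points into.\<close>

definition succ_arc :: "('b \<times> 'b) set" where
  "succ_arc = {(b, a). a \<in> arcs G \<and> b \<in> arcs G \<and> tail G b = head G a \<and> b \<noteq> arev a}"

abbreviation (input) reduced :: "'b list \<Rightarrow> bool" where
  "reduced \<equiv> successively (\<lambda>a b. tail G b = head G a \<and> b \<noteq> arev a)"

lemma cas_reduced: "p \<noteq> [] \<Longrightarrow> reduced p \<Longrightarrow> cas (tail G (hd p)) p (head G (last p))"
proof (induction p)
  case (Cons a p)
  then show ?case by (cases p) auto
qed simp

text \<open>A repeated tail cuts out a shorter closed reduced walk. Otherwise each arc is determined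
  by its tail; then \<open>arev a\<close> on the walk would have to be the arc following
  \<open>a\<close>, which reducedness forbids.\<close>

lemma closed_reduced_walk_imp_cycle:
  assumes "p \<noteq> []" "set p \<subseteq> arcs G" "reduced p" "head G (last p) = tail G (hd p)"
  shows "\<exists>p. cycle p \<and> (\<forall>a\<in>set p. arev a \<notin> set p)"
  using assms
proof (induction p rule: length_induct)
  case (1 p)
  show ?case
  proof (cases "distinct (map (tail G) p)")
    case False
    then obtain xs y ys zs where "map (tail G) p = xs @ [y] @ ys @ [y] @ zs"
      by (meson not_distinct_decomp)
    then obtain p1 a p2 b p3 where p: "p = p1 @ a # p2 @ b # p3" and ab: "tail G a = tail G b"
      by (auto simp: map_eq_append_conv map_eq_Cons_conv Cons_eq_map_conv append_eq_map_conv)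
    have "p = p1 @ (a # p2) @ b # p3" using p by simp
    then have "reduced (a # p2)" "head G (last (a # p2)) = tail G b"
      using "1.prems"(3) by (simp_all only: successively_append_iff) auto
    then show ?thesis
      using "1.IH" "1.prems"(2) ab p by (auto dest!: spec[of _ "a # p2"])
  next
    case True
    then have inj: "inj_on (tail G) (set p)" by (simp add: distinct_map)
    have "cas (tail G (hd p)) p (tail G (hd p))"
      using cas_reduced[OF "1.prems"(1,3)] "1.prems"(4) by simp
    then have "awalk (tail G (hd p)) p (tail G (hd p))"
      using "1.prems"(1,2) hd_in_set[of p] by (auto simp: awalk_def simp del: hd_in_set)
    moreover have "distinct (tl (awalk_verts (tail G (hd p)) p))"
      using True "1.prems"(1,4) by (cases p) (auto simp: awalk_verts_conv)
    ultimately have "cycle p" using "1.prems"(1) unfolding cycle_def by blast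
    moreover have "arev a \<notin> set p" if a: "a \<in> set p" for a
    proof
      assume rev: "arev a \<in> set p"
      have arc: "a \<in> arcs G" using a "1.prems"(2) by auto
      obtain xs ys where p: "p = xs @ a # ys" using a by (meson split_list)
      show False
      proof (cases ys)
        case (Cons b ys')
        then have "tail G b = head G a" "b \<noteq> arev a" "b \<in> set p"
          using "1.prems"(3) p by (auto simp: successively_append_iff)
        then show False using inj_onD[OF inj, of b "arev a"] rev arc by simp
      next
        case Nil
        \<comment> \<open>Nothing is assumed about backtracking where the walk closes up. If the
          last arc \<open>a\<close> is followed cyclically by \<open>arev a\<close>, the
          contradiction comes one arc later: the second arc has the tail of \<open>a\<close>, so it
          equals \<open>a\<close> and reverses the first.\<close>
        then have hd: "hd p = arev a"
          using "1.prems"(1,4) p rev arc inj_onD[OF inj, of "hd p" "arev a"]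
          by (metis hd_in_set last_snoc tail_arev)
        then obtain c q where q: "p = arev a # c # q"
          using p Nil arev_neq[OF arc] by (cases xs; cases "tl xs @ [a]") auto
        then have "tail G c = tail G a" "c \<noteq> a" "c \<in> set p"
          using "1.prems"(3) arc by auto
        then show False using inj_onD[OF inj, of c a] a by simp
      qed
    qed
    ultimately show ?thesis by blast
  qed
qed

lemma wf_succ_arc:
  assumes "finite (arcs G)" and acyclic: "\<not> (\<exists>p. cycle p \<and> (\<forall>a\<in>set p. arev a \<notin> set p))"
  shows "wf succ_arc"
proof (rule finite_acyclic_wf)
  have "succ_arc \<subseteq> arcs G \<times> arcs G" by (auto simp: succ_arc_def)
  then show "finite succ_arc" using assms(1) finite_subset by blast
  \<comment> \<open>The walk starts with \<open>a\<close> and stops just before \<open>b\<close>, so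
    \<open>b = a\<close> closes it. Keeping \<open>b \<noteq> arev (last p)\<close> is what allows
    \<open>b\<close> to be appended.\<close>
  have walk: "\<exists>p. p \<noteq> [] \<and> hd p = a \<and> set p \<subseteq> arcs G \<and> reduced p \<and>
      head G (last p) = tail G b \<and> b \<noteq> arev (last p)" if "(b, a) \<in> succ_arc\<^sup>+" for a b
    using that
  proof (induction rule: converse_trancl_induct)
    case (base b)
    then show ?case by (intro exI[of _ "[a]"]) (auto simp: succ_arc_def)
  next
    case (step b c)
    then obtain p where p: "p \<noteq> []" "hd p = a" "set p \<subseteq> arcs G" "reduced p"
        "head G (last p) = tail G c" "c \<noteq> arev (last p)" by blast
    then show ?case
      using step.hyps(1)
      by (intro exI[of _ "p @ [c]"]) (auto simp: succ_arc_def successively_append_iff)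
  qed
  show "acyclic succ_arc"
    unfolding acyclic_def
  proof safe
    fix a assume "(a, a) \<in> succ_arc\<^sup>+"
    from walk[OF this] acyclic closed_reduced_walk_imp_cycle show False by blast
  qed
qed

text \<open>Spanning tree bound. Every vertex except \<open>r\<close> picks an arc arriving from a
  vertex closer to \<open>r\<close>. Heads distinguish these arcs, and none is the reverse of
  another since distances drop along both; together with their reverses they give
  \<open>2 * (card (verts G) - 1)\<close> arcs. A subset \<open>A\<close> is allowed so that an edge
  can be deleted first.\<close>

lemma card_verts_le_if_connected:
  assumes "finite (verts G)" "finite A" "\<And>a. a \<in> A \<Longrightarrow> arev a \<in> A" "A \<subseteq> arcs G"
    and r: "r \<in> verts G" "\<And>v. v \<in> verts G \<Longrightarrow> (r, v) \<in> ((\<lambda>a. (tail G a, head G a)) ` A)\<^sup>*"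
  shows "2 * card (verts G) \<le> card A + 2"
proof -
  let ?R = "(\<lambda>a. (tail G a, head G a)) ` A"
  define d where "d v = (LEAST k. (r, v) \<in> ?R ^^ k)" for v
  have "\<exists>a\<in>A. head G a = v \<and> d (tail G a) < d v" if v: "v \<in> verts G - {r}" for v
  proof -
    have "\<exists>k. (r, v) \<in> ?R ^^ k" using r(2) v rtrancl_power by blast
    then have dv: "(r, v) \<in> ?R ^^ d v" unfolding d_def by (rule LeastI_ex)
    then obtain m where m: "d v = Suc m" using v by (cases "d v") auto
    then obtain u where u: "(r, u) \<in> ?R ^^ m" "(u, v) \<in> ?R" using dv by auto
    have "d u \<le> m" unfolding d_def using u(1) by (rule Least_le)
    then show ?thesis using u(2) m by auto
  qed
  then obtain e where e: "\<And>v. v \<in> verts G - {r} \<Longrightarrow> e v \<in> A \<and> head G (e v) = v \<and> d (tail G (e v)) < d v"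
    by metis
  let ?X = "e ` (verts G - {r})"
  have "inj_on e (verts G - {r})" using e by (metis inj_onI)
  then have X: "card ?X = card (verts G) - 1"
    using card_image r(1) assms(1) by fastforce
  have "?X \<inter> arev ` ?X = {}"
  proof (rule ccontr)
    assume "?X \<inter> arev ` ?X \<noteq> {}"
    then obtain u v where uv: "u \<in> verts G - {r}" "v \<in> verts G - {r}" "e u = arev (e v)" by auto
    then have "e v \<in> arcs G" using e assms(4) by blast
    then have "u = tail G (e v)" "tail G (e u) = v" using e uv by (metis head_arev, metis tail_arev)
    then show False using e[OF uv(1)] e[OF uv(2)] by simp
  qed
  moreover have "finite ?X" using assms(1) by simp
  ultimately have "card (?X \<union> arev ` ?X) = card ?X + card (arev ` ?X)"
    by (intro card_Un_disjoint) auto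
  also have "card (arev ` ?X) = card ?X" by (intro card_image) auto
  finally have "card ?X + card ?X = card (?X \<union> arev ` ?X)" by simp
  also have "\<dots> \<le> card A" using e assms(2,3) by (intro card_mono) auto
  finally show ?thesis using X by linarith
qed

text \<open>Deleting an edge of a cycle keeps the graph connected, and the remaining arcs are two
  too few for the spanning tree bound.\<close>

lemma connected_no_cycle_if_card:
  assumes fin: "finite (verts G)" "finite (arcs G)" and "connected G"
    and card: "card (arcs G) + 2 \<le> 2 * card (verts G)"
  shows "\<not> (\<exists>p. cycle p \<and> (\<forall>a\<in>set p. arev a \<notin> set p))"
proof safe
  fix p assume "cycle p" and no_rev: "\<forall>a\<in>set p. arev a \<notin> set p"
  then obtain u where u: "awalk u p u" "distinct p" "p \<noteq> []" by (auto simp: cycle_conv)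
  then obtain a q where p: "p = a # q" by (cases p) auto
  define A where "A = arcs G - {a, arev a}"
  let ?R = "(\<lambda>a. (tail G a, head G a)) ` A"
  have a: "a \<in> arcs G" "a \<noteq> arev a" using u p arev_neq[of a] by (auto simp: awalk_def)
  have A: "arev b \<in> A" if "b \<in> A" for b
    using that a unfolding A_def by (auto simp: arev_eq_iff)
  have "sym ?R"
  proof (rule symI)
    fix v w assume "(v, w) \<in> ?R"
    then obtain b where "b \<in> A" "v = tail G b" "w = head G b" by auto
    moreover from this have "b \<in> arcs G" by (simp add: A_def)
    ultimately show "(w, v) \<in> ?R" using A[of b] by (auto intro!: image_eqI[of _ _ "arev b"])
  qed
  have walk: "set q \<subseteq> A \<Longrightarrow> cas v q w \<Longrightarrow> (v, w) \<in> ?R\<^sup>*" for v w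
  proof (induction q arbitrary: v)
    case (Cons b q)
    then have "(v, head G b) \<in> ?R" "(head G b, w) \<in> ?R\<^sup>*" by auto
    then show ?case by (rule converse_rtrancl_into_rtrancl)
  qed auto
  \<comment> \<open>The rest \<open>q\<close> of the cycle leads from the head of \<open>a\<close>
    back to its tail; it avoids \<open>a\<close> by distinctness and \<open>arev a\<close> by
    \<open>no_rev\<close>, so it survives the deletion.\<close>
  have "(head G a, tail G a) \<in> ?R\<^sup>*"
    using u no_rev p by (intro walk) (auto simp: awalk_def A_def)
  then have closing: "(tail G a, head G a) \<in> ?R\<^sup>*"
    using sym_rtrancl[OF \<open>sym ?R\<close>] by (meson symD)
  have "(tail G b, head G b) \<in> ?R\<^sup>*" if b: "b \<in> arcs G" for b
  proof -
    consider "b = a" | "b = arev a" | "b \<in> A" using b by (auto simp: A_def)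
    then show ?thesis
      using closing \<open>(head G a, tail G a) \<in> ?R\<^sup>*\<close> a by cases auto
  qed
  then have reach: "(tail G a, head G b) \<in> ?R\<^sup>*"
    if "b \<in> arcs G" "(tail G a, tail G b) \<in> ?R\<^sup>*" for b
    using that rtrancl_trans by metis
  have "(tail G a, v) \<in> ?R\<^sup>*" if "v \<in> verts G" for v
    by (rule connected_induct[OF assms(3) _ that, where u = "tail G a"]) (use a reach in simp_all)
  then have "2 * card (verts G) \<le> card A + 2"
    using fin a A by (intro card_verts_le_if_connected) (auto simp: A_def)
  moreover have "card A = card (arcs G) - 2" "card (arcs G) \<ge> 2"
  proof -
    have "{a, arev a} \<subseteq> arcs G" using a by simp
    moreover have "card {a, arev a} = 2" using a by simp
    ultimately show "card A = card (arcs G) - 2" "card (arcs G) \<ge> 2"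
      unfolding A_def using fin(2) by (metis card_Diff_subset finite.emptyI finite.insertI, metis card_mono)
  qed
  ultimately show False using card by linarith
qed

end

section \<open>The walk around a decorated plane tree\<close>

locale decorated_tree =
  fixes T :: "('v, 'a) decorated_map"
  assumes decorated: "decorated_plane_tree T"
begin

sublocale bidirected_digraph "graph T" "flip T"
  using decorated by (simp add: decorated_plane_tree_def plane_tree_def)

sublocale fin_digraph "graph T"
  using decorated by (simp add: decorated_plane_tree_def plane_tree_def)

lemma connected_graph: "connected (graph T)"
  using decorated by (simp add: decorated_plane_tree_def plane_tree_def)

lemma wf_succ: "wf succ_arc"
  using decorated finite_arcs by (intro wf_succ_arc) (auto simp: decorated_plane_tree_def plane_tree_def)

lemma cyclic_on_rot:
  assumes "a \<in> arcs (graph T)" shows "cyclic_on (rot T) (out_arcs (graph T) (tail (graph T) a))"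
proof -
  have "tail (graph T) a \<in> verts (graph T)" "a \<in> out_arcs (graph T) (tail (graph T) a)"
    using assms by auto
  then show ?thesis
    using decorated unfolding decorated_plane_tree_def plane_tree_def by blast
qed

lemma rot_permutes: "rot T permutes arcs (graph T)"
  using decorated by (simp add: decorated_plane_tree_def plane_tree_def)

lemma rot_in_arcs: "a \<in> arcs (graph T) \<Longrightarrow> rot T a \<in> arcs (graph T)"
  and tail_rot: "a \<in> arcs (graph T) \<Longrightarrow> tail (graph T) (rot T a) = tail (graph T) a"
  using cyclic_on_inI[OF cyclic_on_rot, of a a] by auto

lemma orbit_rot:
  assumes "a \<in> arcs (graph T)" "b \<in> arcs (graph T)"
  shows "b \<in> orbit (rot T) a \<longleftrightarrow> tail (graph T) a = tail (graph T) b"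
  using orbit_cyclic_eq3[OF cyclic_on_rot[OF assms(1)], of a] assms by auto

lemma marked_unique_arc:
  assumes "tail (graph T) a \<in> marked T" "a \<in> arcs (graph T)" "b \<in> arcs (graph T)"
    "tail (graph T) a = tail (graph T) b"
  shows "a = b"
proof -
  have "card (out_arcs (graph T) (tail (graph T) a)) = 1"
    using decorated assms(1) by (auto simp: decorated_plane_tree_def out_degree_def)
  then obtain c where "out_arcs (graph T) (tail (graph T) a) = {c}" by (rule card_1_singletonE)
  moreover have "a \<in> out_arcs (graph T) (tail (graph T) a)" "b \<in> out_arcs (graph T) (tail (graph T) a)"
    using assms by auto
  ultimately show ?thesis by (metis singletonD)
qed

text \<open>These arcs play the part of the triangles. On them \<open>red\<close> imitates
  \<open>\<tau> Red\<close>: an arc into a marked leaf is folded, hence fixed, because its reverse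
  is not a leg.\<close>

definition legs :: "'a set" where
  "legs = {a \<in> arcs (graph T). tail (graph T) a \<notin> marked T}"

definition red :: "'a \<Rightarrow> 'a" where
  "red a = (if a \<in> legs \<and> head (graph T) a \<notin> marked T then flip T a else a)"

text \<open>The tree counterpart of \<open>\<tau> Green \<circ> \<tau> Blue\<close>: since
  \<open>rot\<close> corresponds to red after green after blue, composing with \<open>red\<close>
  once more cancels the red factor.\<close>

definition face :: "'a \<Rightarrow> 'a" where
  "face a = (if a \<in> legs then red (rot T a) else a)"

lemma finite_legs: "finite legs" by (simp add: legs_def)

lemma red_in_legs: "a \<in> legs \<Longrightarrow> red a \<in> legs"
  by (auto simp: red_def legs_def)

lemma red_red: "red (red a) = a"
  by (auto simp: red_def legs_def)

lemma rot_in_legs: "a \<in> legs \<Longrightarrow> rot T a \<in> legs"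
  by (auto simp: legs_def rot_in_arcs tail_rot)

lemma face_permutes: "face permutes legs"
proof (rule bij_imp_permutes)
  have "inj_on (rot T) legs" using rot_permutes permutes_inj inj_on_subset by blast
  then have "inj_on face legs"
    unfolding face_def inj_on_def using red_red by metis
  moreover have "face ` legs \<subseteq> legs" by (auto simp: face_def red_in_legs rot_in_legs)
  ultimately show "bij_betw face legs legs"
    using endo_inj_surj[OF finite_legs] by (simp add: bij_betw_def)
qed (simp add: face_def)

lemma face_permutation: "permutation face"
  using face_permutes finite_legs permutation_permutes by blast

lemma face_orbit_sym: "a \<in> orbit face b \<Longrightarrow> b \<in> orbit face a"
  using orbit_swap permutation_self_in_orbit[OF face_permutation] by metis

text \<open>After arriving along an arc, the walk around the face explores the whole subtree ahead and
  then returns along the same arc.\<close>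

lemma red_face_orbit: "a \<in> legs \<Longrightarrow> a \<in> orbit face (red a)"
proof (induction a rule: wf_induct_rule[OF wf_succ])
  case (1 a)
  have arc: "a \<in> arcs (graph T)" using "1.prems" by (simp add: legs_def)
  show ?case
  proof (cases "head (graph T) a \<in> marked T")
    case True
    then show ?thesis using permutation_self_in_orbit[OF face_permutation] by (simp add: red_def)
  next
    case False
    define x where "x = red a"
    have x: "x = flip T a" "x \<in> legs" "red x = a"
      using "1.prems" False red_in_legs[of a] red_red[of a] unfolding x_def by (simp_all add: red_def)
    have rot_x: "(rot T ^^ i) x \<in> legs \<and> tail (graph T) ((rot T ^^ i) x) = head (graph T) a" for i
      by (induction i) (use x arc in \<open>auto simp: rot_in_legs tail_rot legs_def rot_in_arcs\<close>)
    \<comment> \<open>Turning about the head of \<open>a\<close> from \<open>x\<close>,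
      \<open>face\<close> jumps to the far side of the next arc, and the induction hypothesis
      returns from its subtree to that arc. This works until the turn is back at \<open>x\<close>,
      the only arc there that does not continue \<open>a\<close>.\<close>
    have ind: "(rot T ^^ i) x \<in> orbit face x" if "\<And>j. 0 < j \<Longrightarrow> j \<le> i \<Longrightarrow> (rot T ^^ j) x \<noteq> x" for i
      using that
    proof (induction i)
      case 0
      then show ?case using permutation_self_in_orbit[OF face_permutation] by simp
    next
      case (Suc i)
      let ?y = "(rot T ^^ Suc i) x"
      have "?y \<noteq> x" using Suc.prems by blast
      then have "(?y, a) \<in> succ_arc"
        using rot_x[of "Suc i"] arc x by (auto simp: succ_arc_def legs_def)
      then have "?y \<in> orbit face (red ?y)" using "1.IH" rot_x by blast
      moreover have "red ?y = face ((rot T ^^ i) x)" using rot_x[of i] by (simp add: face_def)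
      moreover have "(rot T ^^ i) x \<in> orbit face x" using Suc by simp
      ultimately show ?case by (metis orbit.step orbit_trans)
    qed
    have "x \<in> orbit (rot T) x" using orbit_rot x arc by (simp add: legs_def)
    then have "\<exists>d. 0 < d \<and> (rot T ^^ d) x = x" by (auto simp: orbit_altdef)
    \<comment> \<open>The degree of the head of \<open>a\<close>. From the arc just before the full
      turn, \<open>face\<close> rotates to \<open>x\<close> and crosses back to
      \<open>a\<close>.\<close>
    define d where "d = (LEAST d. 0 < d \<and> (rot T ^^ d) x = x)"
    have d: "0 < d \<and> (rot T ^^ d) x = x" unfolding d_def by (rule LeastI_ex) fact
    then obtain i where i: "d = Suc i" by (cases d) auto
    have "(rot T ^^ j) x \<noteq> x" if "0 < j" "j \<le> i" for j
      using not_less_Least[of j "\<lambda>d. 0 < d \<and> (rot T ^^ d) x = x"] that i unfolding d_def by auto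
    then have "(rot T ^^ i) x \<in> orbit face x" by (rule ind)
    then have "face ((rot T ^^ i) x) \<in> orbit face x" by (rule orbit.step)
    moreover have "face ((rot T ^^ i) x) = a" using rot_x[of i] d i x(3) by (simp add: face_def)
    ultimately show ?thesis by (simp add: x_def)
  qed
qed

lemma rot_face_orbit:
  assumes "a \<in> legs" shows "rot T a \<in> orbit face a"
proof -
  have "rot T a \<in> orbit face (face a)"
    using red_face_orbit[OF rot_in_legs[OF assms]] assms by (simp add: face_def)
  then show ?thesis by (rule orbit_subset)
qed

lemma tail_eq_face_orbit:
  assumes "a \<in> legs" "b \<in> arcs (graph T)" "tail (graph T) a = tail (graph T) b"
  shows "b \<in> orbit face a"
proof -
  have "b \<in> orbit (rot T) a" using assms by (simp add: orbit_rot legs_def)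
  then have "b \<in> orbit face a \<and> b \<in> legs"
  proof induction
    case base
    then show ?case using assms(1) rot_face_orbit rot_in_legs by blast
  next
    case (step b)
    then show ?case using rot_face_orbit rot_in_legs orbit_trans by metis
  qed
  then show ?thesis ..
qed

lemma cyclic_on_face:
  assumes "legs \<noteq> {}" shows "cyclic_on face legs"
proof -
  obtain a where a: "a \<in> legs" using assms by blast
  \<comment> \<open>The property spreads along arcs by connectedness. A marked leaf has no outgoing
    legs, so there the property must remember the leg coming in; otherwise nothing could be passed
    on when leaving the leaf.\<close>
  define P where "P v \<longleftrightarrow> (\<forall>b\<in>legs. (tail (graph T) b = v \<or> v \<in> marked T \<and> head (graph T) b = v)
      \<longrightarrow> b \<in> orbit face a)" for v
  have P: "P v" if "v \<in> verts (graph T)" for v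
  proof (rule connected_induct[OF connected_graph _ that])
    show "tail (graph T) a \<in> verts (graph T)" using a by (simp add: legs_def)
    show "P (tail (graph T) a)"
      unfolding P_def using a tail_eq_face_orbit[OF a] by (simp add: legs_def)
    fix e assume e: "e \<in> arcs (graph T)" and P: "P (tail (graph T) e)"
    show "P (head (graph T) e)"
    proof (cases "head (graph T) e \<in> marked T")
      case True
      have "b \<in> orbit face a" if b: "b \<in> legs" "head (graph T) b = head (graph T) e" for b
      proof -
        have "flip T b = flip T e"
          by (rule marked_unique_arc) (use e b True in \<open>simp_all add: legs_def\<close>)
        then have "b = e" by (simp add: arev_eq_iff)
        then show ?thesis using P b by (auto simp: P_def)
      qed
      then show ?thesis using True by (auto simp: P_def legs_def)
    next
      case False
      then have flip: "flip T e \<in> legs" using e by (simp add: legs_def)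
      have "flip T e \<in> orbit face a"
      proof (cases "tail (graph T) e \<in> marked T")
        case True
        then show ?thesis using P flip e by (auto simp: P_def)
      next
        case tail: False
        then have "e \<in> legs" using e by (simp add: legs_def)
        then have "e \<in> orbit face a" using P by (simp add: P_def)
        moreover have "flip T e \<in> orbit face e"
          using red_face_orbit[OF \<open>e \<in> legs\<close>] face_orbit_sym False \<open>e \<in> legs\<close> by (simp add: red_def)
        ultimately show ?thesis by (rule orbit_trans[rotated])
      qed
      then have "b \<in> orbit face a" if "b \<in> legs" "tail (graph T) b = head (graph T) e" for b
        using tail_eq_face_orbit[OF flip, of b] that e orbit_trans by (auto simp: legs_def)
      then show ?thesis using False by (auto simp: P_def)
    qed
  qed
  have "legs \<subseteq> orbit face a"
  proof
    fix b assume b: "b \<in> legs"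
    then have "P (tail (graph T) b)" by (intro P) (simp add: legs_def)
    then show "b \<in> orbit face a" using b by (simp add: P_def)
  qed
  moreover have "orbit face a \<subseteq> legs" using face_permutes a by (rule permutes_orbit_subset)
  ultimately show ?thesis using a unfolding cyclic_on_def by blast
qed

end

section \<open>The red graph of a surface\<close>

lemma sum_count_eq_sum_mset:
  fixes f :: "'a \<Rightarrow> int"
  shows "(\<Sum>i\<in>set_mset M. int (count M i) * f i) = (\<Sum>i\<in>#M. f i)"
proof -
  \<comment> \<open>A fixed finite index set containing the support stays unchanged in the induction
    on \<open>M\<close>.\<close>
  have "finite A \<Longrightarrow> set_mset M \<subseteq> A \<Longrightarrow> (\<Sum>i\<in>A. int (count M i) * f i) = (\<Sum>i\<in>#M. f i)" for A
  proof (induction M)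
    case (add x M)
    have "(\<Sum>i\<in>A. int (count (add_mset x M) i) * f i) =
        (\<Sum>i\<in>A. int (count M i) * f i + (if i = x then f i else 0))"
      by (intro sum.cong) (auto simp: algebra_simps)
    then show ?case using add by (simp add: sum.distrib)
  qed simp
  then show ?thesis by simp
qed

lemma tree_profile_iff:
  assumes "finite (verts (graph T))"
  shows "tree_profile T \<mu> l \<longleftrightarrow> card (marked T) = l \<and>
    \<mu> = image_mset (out_degree (graph T)) (mset_set (verts (graph T) - marked T))"
proof -
  have "count (image_mset (out_degree (graph T)) (mset_set (verts (graph T) - marked T))) i =
      card {v \<in> verts (graph T) - marked T. out_degree (graph T) v = i}" for i
  proof -
    let ?A = "verts (graph T) - marked T"
    have "out_degree (graph T) -` {i} \<inter> set_mset (mset_set ?A) = {v \<in> ?A. out_degree (graph T) v = i}"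
      using assms by auto
    moreover have "(\<Sum>v | v \<in> ?A \<and> out_degree (graph T) v = i. count (mset_set ?A) v) =
        (\<Sum>v | v \<in> ?A \<and> out_degree (graph T) v = i. 1)"
      using assms by (intro sum.cong) auto
    ultimately show ?thesis unfolding count_image_mset by simp
  qed
  then show ?thesis unfolding tree_profile_def multiset_eq_iff by simp
qed

lemma tree_iso_tree_profile:
  assumes "tree_iso T T'" "wf_digraph (graph T)" "wf_digraph (graph T')" "marked T \<subseteq> verts (graph T)"
  shows "tree_profile T \<mu> l \<longleftrightarrow> tree_profile T' \<mu> l"
proof -
  interpret T: wf_digraph "graph T" by fact
  interpret T': wf_digraph "graph T'" by fact
  obtain f g where f: "bij_betw f (verts (graph T)) (verts (graph T'))"
    and g: "bij_betw g (arcs (graph T)) (arcs (graph T'))"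
    and marked: "f ` marked T = marked T'"
    and tail: "\<And>a. a \<in> arcs (graph T) \<Longrightarrow> tail (graph T') (g a) = f (tail (graph T) a)"
    using assms(1) unfolding tree_iso_def by blast
  have inj: "inj_on f (verts (graph T))" using f by (rule bij_betw_imp_inj_on)
  have deg: "out_degree (graph T') (f v) = out_degree (graph T) v" if "v \<in> verts (graph T)" for v
  proof -
    have "out_arcs (graph T') (f v) = g ` out_arcs (graph T) v"
    proof (intro set_eqI iffI)
      fix b assume b: "b \<in> out_arcs (graph T') (f v)"
      then obtain a where a: "a \<in> arcs (graph T)" "b = g a" using g by (auto simp: bij_betw_def)
      then have "tail (graph T) a = v" using b tail that by (auto intro: inj_onD[OF inj])
      then show "b \<in> g ` out_arcs (graph T) v" using a by simp
    qed (use g tail in \<open>auto simp: bij_betw_def\<close>)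
    moreover have "inj_on g (out_arcs (graph T) v)"
      using g by (auto simp: bij_betw_def intro: inj_on_subset)
    ultimately show ?thesis by (simp add: out_degree_def card_image)
  qed
  have "{v \<in> verts (graph T') - marked T'. out_degree (graph T') v = i} =
      f ` {v \<in> verts (graph T) - marked T. out_degree (graph T) v = i}" for i
  proof -
    have "verts (graph T') - marked T' = f ` (verts (graph T) - marked T)"
      using f inj marked assms(4) by (simp add: inj_on_image_set_diff[OF inj] bij_betw_def)
    then show ?thesis using deg by auto
  qed
  moreover have "inj_on f {v \<in> verts (graph T) - marked T. out_degree (graph T) v = i}" for i
    by (rule inj_on_subset[OF inj]) auto
  moreover have "card (marked T') = card (marked T)"
    unfolding marked[symmetric] by (rule card_image, rule inj_on_subset[OF inj assms(4)])
  ultimately show ?thesis by (simp add: tree_profile_def card_image)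
qed

section \<open>Vertices of the triangulation as cycles of red-green-blue\<close>

locale involution_triple =
  fixes n :: nat and \<tau> :: triple
  assumes permutes: "\<tau> c permutes {1..n}" and invol: "\<tau> c (\<tau> c a) = a"
begin

definition around :: "nat \<Rightarrow> nat" where
  "around = \<tau> Red \<circ> \<tau> Green \<circ> \<tau> Blue"

lemma around_permutes: "around permutes {1..n}"
  unfolding around_def using permutes by (intro permutes_compose)

lemma around_permutation: "permutation around"
  using around_permutes permutation_permutes by blast

lemma in_iff: "\<tau> c a \<in> {1..n} \<longleftrightarrow> a \<in> {1..n}"
  using permutes by (rule permutes_in_image)

text \<open>A representative for each corner: the triangle whose corner with colour
  \<open>Red\<close> is reached by following gluings backwards, from blue to green to red.\<close>

fun red_corner :: "nat \<times> colour \<Rightarrow> nat" where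
  "red_corner (j, Red) = j"
| "red_corner (j, Green) = \<tau> Red j"
| "red_corner (j, Blue) = \<tau> Red (\<tau> Green j)"

lemma surface_vertex_eq_iff:
  "surface_vertex n \<tau> x = surface_vertex n \<tau> y \<longleftrightarrow>
     (x, y) \<in> (corner_gluing n \<tau> \<union> (corner_gluing n \<tau>)\<inverse>)\<^sup>*"
proof -
  have "sym ((corner_gluing n \<tau> \<union> (corner_gluing n \<tau>)\<inverse>)\<^sup>*)"
    by (rule sym_rtrancl) (rule sym_Un_converse)
  then show ?thesis
    unfolding surface_vertex_def by (auto dest: symD intro: rtrancl_trans)
qed

lemma surface_vertex_step:
  "j \<in> {1..n} \<Longrightarrow> surface_vertex n \<tau> (j, c) = surface_vertex n \<tau> (\<tau> c j, next_colour c)"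
  unfolding surface_vertex_eq_iff by (rule r_into_rtrancl) (auto simp: corner_gluing_def)

lemma surface_vertex_red_corner:
  assumes "fst x \<in> {1..n}"
  shows "surface_vertex n \<tau> x = surface_vertex n \<tau> (red_corner x, Red)"
proof -
  obtain j c where x: "x = (j, c)" by fastforce
  have green: "surface_vertex n \<tau> (i, Green) = surface_vertex n \<tau> (\<tau> Red i, Red)"
    if "i \<in> {1..n}" for i
    using surface_vertex_step[of "\<tau> Red i" Red] that in_iff by (simp add: invol)
  moreover have "surface_vertex n \<tau> (j, Blue) = surface_vertex n \<tau> (\<tau> Green j, Green)"
    using surface_vertex_step[of "\<tau> Green j" Green] assms in_iff by (simp add: invol x)
  ultimately show ?thesis
    using assms in_iff[of Green j] x by (cases c) simp_all
qed

text \<open>Gluings along red and green sides preserve \<open>red_corner\<close> exactly. Gluing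
  along a blue side replaces \<open>\<tau> Red (\<tau> Green j)\<close> by
  \<open>\<tau> Blue j\<close>, of which it is the image under \<open>around\<close>; hence only the
  orbit is invariant.\<close>

lemma orbit_red_corner:
  assumes "(x, y) \<in> corner_gluing n \<tau>"
  shows "orbit around (red_corner x) = orbit around (red_corner y)"
proof -
  obtain j c where xy: "x = (j, c)" "y = (\<tau> c j, next_colour c)"
    using assms by (auto simp: corner_gluing_def)
  have "around (\<tau> Blue j) = \<tau> Red (\<tau> Green j)" by (simp add: around_def invol)
  then have "orbit around (\<tau> Red (\<tau> Green j)) = orbit around (\<tau> Blue j)"
    using permutation_orbit_step[OF around_permutation, of "\<tau> Blue j"] by simp
  then show ?thesis using xy by (cases c) (simp_all add: invol)
qed

text \<open>One direction is the invariance of the orbit of \<open>red_corner\<close> under gluing;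
  for the other, one application of \<open>around\<close> is a chain of gluings about the
  vertex.\<close>

lemma surface_vertex_Red_eq_iff:
  assumes "i \<in> {1..n}"
  shows "surface_vertex n \<tau> (i, Red) = surface_vertex n \<tau> (j, Red) \<longleftrightarrow> j \<in> orbit around i"
proof
  assume "surface_vertex n \<tau> (i, Red) = surface_vertex n \<tau> (j, Red)"
  then have "((i, Red), (j, Red)) \<in> (corner_gluing n \<tau> \<union> (corner_gluing n \<tau>)\<inverse>)\<^sup>*"
    by (simp add: surface_vertex_eq_iff)
  then have "orbit around (red_corner (i, Red)) = orbit around (red_corner (j, Red))"
    by induction (auto dest: orbit_red_corner)
  then show "j \<in> orbit around i"
    using permutation_self_in_orbit[OF around_permutation, of j] by simp
next
  have step: "surface_vertex n \<tau> (a, Red) = surface_vertex n \<tau> (around a, Red)" if "a \<in> {1..n}" for a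
  proof -
    have "surface_vertex n \<tau> (\<tau> Blue a, Blue) = surface_vertex n \<tau> (a, Red)"
      using surface_vertex_step[of "\<tau> Blue a" Blue] that in_iff by (simp add: invol)
    moreover have "surface_vertex n \<tau> (\<tau> Blue a, Blue) = surface_vertex n \<tau> (around a, Red)"
      using surface_vertex_red_corner[of "(\<tau> Blue a, Blue)"] that in_iff by (simp add: around_def)
    ultimately show ?thesis by simp
  qed
  assume "j \<in> orbit around i"
  then have "surface_vertex n \<tau> (i, Red) = surface_vertex n \<tau> (j, Red) \<and> j \<in> {1..n}"
  proof induction
    case base
    then show ?case using step[OF assms] assms permutes_in_image[OF around_permutes, of i] by simp
  next
    case (step a)
    then show ?case using \<open>\<And>a. _ \<Longrightarrow> _ = surface_vertex n \<tau> (around a, Red)\<close>[of a]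
      permutes_in_image[OF around_permutes, of a] by simp
  qed
  then show "surface_vertex n \<tau> (i, Red) = surface_vertex n \<tau> (j, Red)" ..
qed

definition origin :: "nat \<Rightarrow> tree_vertex" where
  "origin j = Vertex (surface_vertex n \<tau> (j, Red))"

lemma origin_eq_iff: "i \<in> {1..n} \<Longrightarrow> origin i = origin j \<longleftrightarrow> j \<in> orbit around i"
  by (simp add: origin_def surface_vertex_Red_eq_iff)

lemma origin_neq_Fold [simp]: "origin i \<noteq> Fold j" "Fold j \<noteq> origin i"
  by (simp_all add: origin_def)

lemma folded_iff: "j \<in> folded n \<tau> \<longleftrightarrow> j \<in> {1..n} \<and> \<tau> Red j = j"
  by (simp add: folded_def)

lemma finite_folded: "finite (folded n \<tau>)"
  by (simp add: folded_def)

lemma tree_of_simps: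
  "verts (graph (tree_of n \<tau>)) = origin ` {1..n} \<union> Fold ` folded n \<tau>"
  "arcs (graph (tree_of n \<tau>)) = Leg ` {1..n} \<union> Stub ` folded n \<tau>"
  "marked (tree_of n \<tau>) = Fold ` folded n \<tau>"
  "tail (graph (tree_of n \<tau>)) (Leg j) = origin j"
  "tail (graph (tree_of n \<tau>)) (Stub j) = Fold j"
  "head (graph (tree_of n \<tau>)) (Stub j) = origin j"
  "rot (tree_of n \<tau>) (Leg j) = Leg (around j)"
  "rot (tree_of n \<tau>) (Stub j) = Stub j"
  "j \<in> {1..n} \<Longrightarrow> head (graph (tree_of n \<tau>)) (Leg j) =
     (if \<tau> Red j = j then Fold j else origin (\<tau> Red j))"
  "j \<in> {1..n} \<Longrightarrow> flip (tree_of n \<tau>) (Leg j) = (if \<tau> Red j = j then Stub j else Leg (\<tau> Red j))"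
  "j \<in> folded n \<tau> \<Longrightarrow> flip (tree_of n \<tau>) (Stub j) = Leg j"
proof -
  have "(\<lambda>x. Vertex (surface_vertex n \<tau> x)) ` ({1..n} \<times> UNIV) = origin ` {1..n}"
  proof safe
    fix j c assume j: "j \<in> {1..n}"
    then have "red_corner (j, c) \<in> {1..n}" by (cases c) (simp_all add: in_iff del: atLeastAtMost_iff)
    then show "Vertex (surface_vertex n \<tau> (j, c)) \<in> origin ` {1..n}"
      using surface_vertex_red_corner[of "(j, c)"] j by (auto simp: origin_def)
  qed (auto simp: origin_def)
  then show "verts (graph (tree_of n \<tau>)) = origin ` {1..n} \<union> Fold ` folded n \<tau>"
    by (simp add: tree_of_def red_graph_def)
  show "head (graph (tree_of n \<tau>)) (Leg j) = (if \<tau> Red j = j then Fold j else origin (\<tau> Red j))"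
    if "j \<in> {1..n}"
    using that surface_vertex_red_corner[of "(j, Green)"]
    by (simp add: tree_of_def red_graph_def folded_iff origin_def)
qed (auto simp: tree_of_def red_graph_def origin_def around_def folded_iff)

lemma out_arcs_origin:
  assumes "j \<in> {1..n}"
  shows "out_arcs (graph (tree_of n \<tau>)) (origin j) = Leg ` orbit around j"
proof -
  have "orbit around j \<subseteq> {1..n}" using around_permutes assms by (rule permutes_orbit_subset)
  moreover have "origin i = origin j \<longleftrightarrow> i \<in> orbit around j" for i
    using origin_eq_iff[OF assms, of i] by auto
  ultimately show ?thesis
    by (auto simp: out_arcs_def tree_of_simps simp del: atLeastAtMost_iff)
qed

lemma out_arcs_Fold:
  assumes "j \<in> folded n \<tau>"
  shows "out_arcs (graph (tree_of n \<tau>)) (Fold j) = {Stub j}"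
  using assms by (auto simp: out_arcs_def tree_of_simps)

lemma marked_tree_of: "marked (tree_of n \<tau>) \<subseteq> verts (graph (tree_of n \<tau>))"
  by (simp add: tree_of_simps)

lemma verts_tree_of_unmarked: "verts (graph (tree_of n \<tau>)) - marked (tree_of n \<tau>) = origin ` {1..n}"
  by (auto simp: tree_of_simps)

text \<open>Unmarked vertices are the cycles of \<open>around\<close>, with degree equal to cycle
  length. \<open>F\<close> sends a vertex to its cycle, injectively, so the multisets of degrees and
  of lengths agree.\<close>

lemma tree_profile_tree_of:
  "tree_profile (tree_of n \<tau>) \<mu> l \<longleftrightarrow>
     cycle_type n (\<tau> Red \<circ> \<tau> Green \<circ> \<tau> Blue) = \<mu> \<and> card (folded n \<tau>) = l"
proof -
  define F where "F v = {i \<in> {1..n}. origin i = v}" for v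
  have F: "F (origin j) = orbit around j" if "j \<in> {1..n}" for j
    using origin_eq_iff[OF that] permutes_orbit_subset[OF around_permutes that]
    unfolding F_def by (auto simp: eq_commute[of "origin _" "origin j"])
  have inj: "inj_on F (origin ` {1..n})"
    using permutation_self_in_orbit[OF around_permutation]
    by (intro inj_onI) (auto simp: F origin_eq_iff simp del: atLeastAtMost_iff)
  have "card (F v) = out_degree (graph (tree_of n \<tau>)) v" if "v \<in> origin ` {1..n}" for v
    using that by (auto simp: F out_degree_def out_arcs_origin card_image inj_on_def simp del: atLeastAtMost_iff)
  then have "image_mset (out_degree (graph (tree_of n \<tau>))) (mset_set (origin ` {1..n})) =
      image_mset card (image_mset F (mset_set (origin ` {1..n})))"
    unfolding image_mset.compositionality by (intro image_mset_cong) (auto simp del: atLeastAtMost_iff)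
  also have "image_mset F (mset_set (origin ` {1..n})) = mset_set (F ` origin ` {1..n})"
    using inj by (rule image_mset_mset_set)
  also have "F ` origin ` {1..n} = orbit around ` {1..n}"
    unfolding image_image using F by (intro image_cong) auto
  finally have "image_mset (out_degree (graph (tree_of n \<tau>))) (mset_set (origin ` {1..n})) =
      cycle_type n around" by (simp add: cycle_type_def)
  moreover have "card (marked (tree_of n \<tau>)) = card (folded n \<tau>)"
    by (simp add: tree_of_simps card_image inj_on_def)
  moreover have "finite (verts (graph (tree_of n \<tau>)))" by (simp add: tree_of_simps finite_folded)
  ultimately show ?thesis
    unfolding tree_profile_iff[OF \<open>finite _\<close>] verts_tree_of_unmarked by (auto simp: around_def)
qed

sublocale tree: bidirected_digraph "graph (tree_of n \<tau>)" "flip (tree_of n \<tau>)"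
proof -
  interpret wf_digraph "graph (tree_of n \<tau>)"
  proof
    fix e assume "e \<in> arcs (graph (tree_of n \<tau>))"
    then show "tail (graph (tree_of n \<tau>)) e \<in> verts (graph (tree_of n \<tau>))"
      "head (graph (tree_of n \<tau>)) e \<in> verts (graph (tree_of n \<tau>))"
      by (auto simp: tree_of_simps folded_iff in_iff simp del: atLeastAtMost_iff)
  qed
  show "bidirected_digraph (graph (tree_of n \<tau>)) (flip (tree_of n \<tau>))"
  proof (rule bidirected_digraphI)
    fix a
    show "flip (tree_of n \<tau>) a = a" if "a \<notin> arcs (graph (tree_of n \<tau>))"
      using that by (simp add: tree_of_def)
    assume "a \<in> arcs (graph (tree_of n \<tau>))"
    then show "flip (tree_of n \<tau>) a \<noteq> a" "flip (tree_of n \<tau>) (flip (tree_of n \<tau>) a) = a"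
      "tail (graph (tree_of n \<tau>)) (flip (tree_of n \<tau>) a) = head (graph (tree_of n \<tau>)) a"
      by (auto simp: tree_of_simps folded_iff in_iff invol simp del: atLeastAtMost_iff split: if_splits)
  qed
qed

sublocale tree: fin_digraph "graph (tree_of n \<tau>)"
  by unfold_locales (simp_all add: tree_of_simps finite_folded)

lemma rot_tree_of_permutes: "rot (tree_of n \<tau>) permutes arcs (graph (tree_of n \<tau>))"
proof (rule bij_imp_permutes)
  have inj: "inj_on (rot (tree_of n \<tau>)) (arcs (graph (tree_of n \<tau>)))"
    by (rule inj_onI) (auto simp: tree_of_simps inj_eq[OF permutes_inj[OF around_permutes]])
  have "rot (tree_of n \<tau>) ` arcs (graph (tree_of n \<tau>)) \<subseteq> arcs (graph (tree_of n \<tau>))"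
    using permutes_in_image[OF around_permutes] by (auto simp: tree_of_simps)
  then show "bij_betw (rot (tree_of n \<tau>)) (arcs (graph (tree_of n \<tau>))) (arcs (graph (tree_of n \<tau>)))"
    using inj endo_inj_surj[OF tree.finite_arcs] by (simp add: bij_betw_def)
  show "rot (tree_of n \<tau>) a = a" if "a \<notin> arcs (graph (tree_of n \<tau>))" for a
    using that permutes_not_in[OF around_permutes]
    by (cases a) (auto simp: tree_of_simps image_iff simp del: atLeastAtMost_iff)
qed

lemma cyclic_on_rot_tree_of:
  assumes "v \<in> verts (graph (tree_of n \<tau>))"
  shows "cyclic_on (rot (tree_of n \<tau>)) (out_arcs (graph (tree_of n \<tau>)) v)"
proof -
  consider j where "j \<in> {1..n}" "v = origin j" | j where "j \<in> folded n \<tau>" "v = Fold j"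
    using assms by (auto simp: tree_of_simps)
  then show ?thesis
  proof cases
    case 1
    have "cyclic_on around (orbit around j)" using around_permutation by (rule cyclic_on_orbit')
    then have "cyclic_on (rot (tree_of n \<tau>)) (Leg ` orbit around j)"
      by (rule cyclic_on_image) (simp add: tree_of_simps)
    then show ?thesis using 1 by (simp add: out_arcs_origin)
  next
    case 2
    have "orbit (rot (tree_of n \<tau>)) (Stub j) = {Stub j}"
      by (simp add: orbit_eq_singleton_iff tree_of_simps)
    then show ?thesis using 2 by (auto simp: out_arcs_Fold cyclic_on_def)
  qed
qed

end

lemma cyclic_triple_involution: "cyclic_triple n \<tau> \<Longrightarrow> involution_triple n \<tau>"
  by unfold_locales (auto simp: cyclic_triple_permutes cyclic_triple_invol)

lemma decorated_plane_tree_tree_of: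
  assumes cyc: "cyclic_triple n \<tau>" and n: "n \<ge> 1" and k: "k \<ge> 2"
    and profile: "tree_profile (tree_of n \<tau>) \<mu> (k - 2)" and sum: "sum_mset \<mu> = n"
    and spherical: "(\<Sum>i\<in>set_mset \<mu>. int (count \<mu> i) * (int i - 2)) = int k - 4"
  shows "decorated_plane_tree (tree_of n \<tau>)"
proof -
  interpret involution_triple n \<tau> using cyc by (rule cyclic_triple_involution)
  let ?T = "tree_of n \<tau>"
  have dominates: "tail (graph ?T) a \<rightarrow>\<^sup>*\<^bsub>graph ?T\<^esub> head (graph ?T) a" if "a \<in> arcs (graph ?T)" for a
    using that by (intro tree.reachable_adjI) (auto simp: arcs_ends_conv)
  \<comment> \<open>Applying \<open>around\<close> stays at the same vertex, and one red edge,
    possibly folded, then leads to the origin of the green-blue image. Following the green-blue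
    cycle therefore connects all origins.\<close>
  have origin_step: "origin j \<rightarrow>\<^sup>*\<^bsub>graph ?T\<^esub> origin (\<tau> Green (\<tau> Blue j))" if j: "j \<in> {1..n}" for j
  proof -
    have w: "around j \<in> {1..n}" "\<tau> Red (around j) = \<tau> Green (\<tau> Blue j)"
      using j permutes_in_image[OF around_permutes] by (auto simp: around_def invol)
    have "origin j = origin (around j)" using origin_eq_iff[OF j] orbit.base by metis
    moreover have "origin (around j) \<rightarrow>\<^sup>*\<^bsub>graph ?T\<^esub> origin (\<tau> Red (around j))"
    proof (cases "\<tau> Red (around j) = around j")
      case True
      then show ?thesis using w(1) by (auto simp: tree_of_simps simp del: atLeastAtMost_iff)
    next
      case False
      then show ?thesis using dominates[of "Leg (around j)"] w(1) by (simp add: tree_of_simps)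
    qed
    ultimately show ?thesis using w(2) by simp
  qed
  have root: "origin 1 \<rightarrow>\<^sup>*\<^bsub>graph ?T\<^esub> origin j" if "j \<in> {1..n}" for j
  proof -
    have "1 \<in> {1..n}" using n by simp
    have "orbit (\<tau> Green \<circ> \<tau> Blue) 1 = {1..n}"
      using cyc n unfolding cyclic_triple_def by (intro orbit_cyclic_eq3) auto
    then have "j \<in> orbit (\<tau> Green \<circ> \<tau> Blue) 1" using that by simp
    then have "origin 1 \<rightarrow>\<^sup>*\<^bsub>graph ?T\<^esub> origin j \<and> j \<in> {1..n}"
    proof induction
      case base
      then show ?case using origin_step[OF \<open>1 \<in> {1..n}\<close>] \<open>1 \<in> {1..n}\<close>
        by (simp add: in_iff del: atLeastAtMost_iff)
    next
      case (step i)
      then show ?case using origin_step[of i]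
        by (auto simp: in_iff simp del: atLeastAtMost_iff intro: tree.reachable_trans)
    qed
    then show ?thesis ..
  qed
  have reach: "origin 1 \<rightarrow>\<^sup>*\<^bsub>graph ?T\<^esub> v" if "v \<in> verts (graph ?T)" for v
  proof -
    consider j where "j \<in> {1..n}" "v = origin j" | j where "j \<in> folded n \<tau>" "v = Fold j"
      using \<open>v \<in> _\<close> by (auto simp: tree_of_simps)
    then show ?thesis
    proof cases
      case 2
      then have "origin j \<rightarrow>\<^sup>*\<^bsub>graph ?T\<^esub> v"
        using dominates[of "Leg j"] by (simp add: tree_of_simps folded_iff)
      then show ?thesis using root[of j] 2 tree.reachable_trans by (simp add: folded_iff)
    qed (use root in simp)
  qed
  have conn: "connected (graph ?T)"
    unfolding tree.connected_iff_reachable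
  proof (intro conjI ballI)
    show "verts (graph ?T) \<noteq> {}" using n by (simp add: tree_of_simps)
    show "u \<rightarrow>\<^sup>*\<^bsub>graph ?T\<^esub> v" if "u \<in> verts (graph ?T)" "v \<in> verts (graph ?T)" for u v
      using reach[OF that(1)] reach[OF that(2)] tree.symmetric_reachable' tree.reachable_trans by metis
  qed
  have card_arcs: "card (arcs (graph ?T)) = n + (k - 2)"
  proof -
    have "card (folded n \<tau>) = k - 2" using profile by (simp add: tree_profile_tree_of)
    moreover have "card (Leg ` {1..n} \<union> Stub ` folded n \<tau>) =
        card (Leg ` {1..n}) + card (Stub ` folded n \<tau>)"
      by (rule card_Un_disjoint) (auto simp: finite_folded)
    ultimately show ?thesis by (simp add: tree_of_simps card_image inj_on_def)
  qed
  have "\<mu> = image_mset (out_degree (graph ?T)) (mset_set (verts (graph ?T) - marked ?T))"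
    and marked: "card (marked ?T) = k - 2"
    using profile by (simp_all add: tree_profile_iff)
  then have size: "size \<mu> = card (verts (graph ?T) - marked ?T)"
    by simp
  have card_verts: "card (verts (graph ?T)) = size \<mu> + (k - 2)"
    using marked size card_Diff_subset[OF _ marked_tree_of] card_mono[OF _ marked_tree_of]
      finite_subset[OF marked_tree_of] by simp
  \<comment> \<open>There are \<open>n + (k - 2)\<close> arcs and
    \<open>size \<mu> + (k - 2)\<close> vertices. Sphericity reads
    \<open>n - 2 * size \<mu> = k - 4\<close>, which makes arcs plus 2 equal to twice the number of
    vertices.\<close>
  have "int k - 4 = (\<Sum>i\<in>#\<mu>. int i - 2)"
    using spherical by (simp add: sum_count_eq_sum_mset)
  also have "\<dots> = int (sum_mset \<mu>) - 2 * int (size \<mu>)"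
    by (induction \<mu>) auto
  finally have "card (arcs (graph ?T)) + 2 \<le> 2 * card (verts (graph ?T))"
    using card_arcs card_verts k sum by linarith
  then have "\<not> (\<exists>p. pre_digraph.cycle (graph ?T) p \<and> (\<forall>a\<in>set p. flip ?T a \<notin> set p))"
    by (intro tree.connected_no_cycle_if_card conn) simp_all
  then have "plane_tree ?T"
    unfolding plane_tree_def
    using tree.fin_digraph tree.bidirected_digraph conn rot_tree_of_permutes cyclic_on_rot_tree_of
    by blast
  moreover have "marked ?T \<subseteq> {v \<in> verts (graph ?T). out_degree (graph ?T) v = 1}"
    by (auto simp: tree_of_simps out_degree_def out_arcs_Fold)
  ultimately show ?thesis by (simp add: decorated_plane_tree_def)
qed

section \<open>Labelled trees\<close>

text \<open>The restriction to \<open>Leg\<close> arcs of an isomorphism from the tree of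
  \<open>\<tau>\<close> to \<open>T\<close>. Stubs and vertices are omitted because they can be
  reconstructed; a folded side only has to end in a marked leaf.\<close>

definition labelling :: "nat \<Rightarrow> triple \<Rightarrow> ('v, 'a) decorated_map \<Rightarrow> (nat \<Rightarrow> 'a) \<Rightarrow> bool" where
  "labelling n \<tau> T h \<longleftrightarrow>
     bij_betw h {1..n} {a \<in> arcs (graph T). tail (graph T) a \<notin> marked T} \<and>
     (\<forall>j\<in>{1..n}. rot T (h j) = h (\<tau> Red (\<tau> Green (\<tau> Blue j))) \<and>
        (if \<tau> Red j = j then head (graph T) (h j) \<in> marked T else flip T (h j) = h (\<tau> Red j)))"

lemma (in involution_triple) tree_iso_imp_labelling:
  assumes "tree_iso (tree_of n \<tau>) T"
  shows "\<exists>h. labelling n \<tau> T h"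
proof -
  let ?S = "tree_of n \<tau>"
  obtain f g where f: "bij_betw f (verts (graph ?S)) (verts (graph T))"
    and g: "bij_betw g (arcs (graph ?S)) (arcs (graph T))"
    and marked: "f ` marked ?S = marked T"
    and arc: "\<And>a. a \<in> arcs (graph ?S) \<Longrightarrow>
           tail (graph T) (g a) = f (tail (graph ?S) a) \<and>
           head (graph T) (g a) = f (head (graph ?S) a) \<and>
           flip T (g a) = g (flip ?S a) \<and> rot T (g a) = g (rot ?S a)"
    using assms unfolding tree_iso_def by blast
  have inj: "inj_on f (verts (graph ?S))" using f by (rule bij_betw_imp_inj_on)
  have leg: "Leg j \<in> arcs (graph ?S)" if "j \<in> {1..n}" for j using that by (simp add: tree_of_simps)
  have unmarked: "f (origin j) \<notin> marked T" if j: "j \<in> {1..n}" for j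
  proof
    assume "f (origin j) \<in> marked T"
    then obtain v where v: "v \<in> marked ?S" "f (origin j) = f v" using marked by auto
    moreover have "v \<in> verts (graph ?S)" "origin j \<in> verts (graph ?S)"
      using v(1) marked_tree_of j by (auto simp: tree_of_simps)
    ultimately have "origin j = v" using inj by (meson inj_onD)
    then show False using v(1) by (auto simp: tree_of_simps)
  qed
  have "inj_on Leg {1..n}" by (simp add: inj_on_def)
  moreover have "inj_on g (Leg ` {1..n})"
    by (rule inj_on_subset[OF bij_betw_imp_inj_on[OF g]]) (auto simp: tree_of_simps)
  ultimately have "inj_on (g \<circ> Leg) {1..n}" by (rule comp_inj_on)
  moreover have "(g \<circ> Leg) ` {1..n} = {a \<in> arcs (graph T). tail (graph T) a \<notin> marked T}"
  proof (intro set_eqI iffI)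
    fix a assume "a \<in> (g \<circ> Leg) ` {1..n}"
    then obtain j where "j \<in> {1..n}" "a = g (Leg j)" by auto
    then show "a \<in> {a \<in> arcs (graph T). tail (graph T) a \<notin> marked T}"
      using arc[OF leg] leg unmarked g by (auto simp: tree_of_simps bij_betw_def)
  next
    fix a assume a: "a \<in> {a \<in> arcs (graph T). tail (graph T) a \<notin> marked T}"
    then obtain b where b: "b \<in> arcs (graph ?S)" "a = g b" using g by (auto simp: bij_betw_def)
    show "a \<in> (g \<circ> Leg) ` {1..n}"
    proof (cases b)
      case (Leg j)
      then show ?thesis using b by (auto simp: tree_of_simps)
    next
      case (Stub j)
      then have "Fold j \<in> marked ?S" using b by (auto simp: tree_of_simps)
      then have "tail (graph T) a \<in> marked T" using arc[OF b(1)] b Stub marked by (auto simp: tree_of_simps)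
      then show ?thesis using a by simp
    qed
  qed
  ultimately have "bij_betw (g \<circ> Leg) {1..n} {a \<in> arcs (graph T). tail (graph T) a \<notin> marked T}"
    by (simp add: bij_betw_def)
  moreover have "f (Fold j) \<in> marked T" if "j \<in> {1..n}" "\<tau> Red j = j" for j
    using that marked by (auto simp: tree_of_simps folded_iff)
  ultimately have "labelling n \<tau> T (g \<circ> Leg)"
    unfolding labelling_def using arc[OF leg] by (simp add: tree_of_simps around_def)
  then show ?thesis by blast
qed

context decorated_tree
begin

lemma labelling_iff_legs:
  "labelling n \<tau> T h \<longleftrightarrow> bij_betw h {1..n} legs \<and>
     (\<forall>j\<in>{1..n}. rot T (h j) = h (\<tau> Red (\<tau> Green (\<tau> Blue j))) \<and>
        (if \<tau> Red j = j then head (graph T) (h j) \<in> marked T else flip T (h j) = h (\<tau> Red j)))"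
  by (simp add: labelling_def legs_def)

text \<open>With a leg present the tree is not an isolated vertex, so the vertex map can be seen to
  be onto by looking at arcs only.\<close>

lemma vertex_has_arc:
  assumes "legs \<noteq> {}" "v \<in> verts (graph T)"
  obtains a where "a \<in> arcs (graph T)" "tail (graph T) a = v"
proof -
  obtain b where b: "b \<in> arcs (graph T)" using assms(1) by (auto simp: legs_def)
  have "\<exists>a\<in>arcs (graph T). tail (graph T) a = v"
  proof (rule connected_induct[OF connected_graph _ assms(2), where u = "tail (graph T) b"])
    show "\<exists>a\<in>arcs (graph T). tail (graph T) a = head (graph T) e" if "e \<in> arcs (graph T)" for e
      using that by (intro bexI[of _ "flip T e"]) simp_all
  qed (use b in auto)
  then show ?thesis using that by blast
qed

text \<open>Two adjacent marked leaves would form the whole tree by connectedness, and then every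
  arc would leave a marked leaf, leaving no legs.\<close>

lemma marked_neighbour:
  assumes "legs \<noteq> {}" "a \<in> arcs (graph T)" "tail (graph T) a \<in> marked T"
  shows "head (graph T) a \<notin> marked T"
proof
  assume head: "head (graph T) a \<in> marked T"
  have ends: "v \<in> {tail (graph T) a, head (graph T) a}" if "v \<in> verts (graph T)" for v
  proof (rule connected_induct[OF connected_graph _ that, where u = "tail (graph T) a"])
    fix e assume e: "e \<in> arcs (graph T)" "tail (graph T) e \<in> {tail (graph T) a, head (graph T) a}"
    then consider "tail (graph T) a = tail (graph T) e" | "tail (graph T) (flip T a) = tail (graph T) e"
      using assms(2) by auto
    then have "e = a \<or> e = flip T a"
      using marked_unique_arc[of a e] marked_unique_arc[of "flip T a" e] assms(2,3) head e(1)
      by cases auto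
    then show "head (graph T) e \<in> {tail (graph T) a, head (graph T) a}" using assms(2) by auto
  qed (use assms(2) in auto)
  have "tail (graph T) e \<in> marked T" if "e \<in> arcs (graph T)" for e
    using ends[OF tail_in_verts[OF that]] assms(3) head by auto
  then show False using assms(1) by (auto simp: legs_def)
qed

text \<open>The vertex map is forced: \<open>h\<close> carries \<open>around\<close> to
  \<open>rot\<close>, hence orbits to the stars of unmarked vertices, and a fold point must go to
  the head of its leg.\<close>

lemma labelling_imp_tree_iso:
  assumes "involution_triple n \<tau>" and h: "labelling n \<tau> T h" and n: "n \<ge> 1"
  shows "tree_iso (tree_of n \<tau>) T"
proof -
  interpret involution_triple n \<tau> by fact
  let ?S = "tree_of n \<tau>"
  have bij: "bij_betw h {1..n} legs"
    and rot: "\<And>j. j \<in> {1..n} \<Longrightarrow> rot T (h j) = h (around j)"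
    and fold: "\<And>j. j \<in> {1..n} \<Longrightarrow> \<tau> Red j = j \<Longrightarrow> head (graph T) (h j) \<in> marked T"
    and flip: "\<And>j. j \<in> {1..n} \<Longrightarrow> \<tau> Red j \<noteq> j \<Longrightarrow> flip T (h j) = h (\<tau> Red j)"
    using h unfolding labelling_iff_legs around_def by auto
  have ne: "legs \<noteq> {}" using bij n by (auto simp: bij_betw_def)
  have leg: "h j \<in> legs" if "j \<in> {1..n}" for j using bij that by (auto simp: bij_betw_def)
  then have arc: "h j \<in> arcs (graph T)" if "j \<in> {1..n}" for j using that by (simp add: legs_def)
  have inj: "inj_on h {1..n}" using bij by (rule bij_betw_imp_inj_on)
  have surj: "\<exists>j\<in>{1..n}. a = h j" if "a \<in> legs" for a
    using that bij_betw_imp_surj_on[OF bij] by blast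
  have tail_eq: "tail (graph T) (h i) = tail (graph T) (h j) \<longleftrightarrow> origin i = origin j"
    if "i \<in> {1..n}" "j \<in> {1..n}" for i j
  proof -
    have "h ` orbit around i = orbit (rot T) (h i)"
      using permutation_self_in_orbit[OF around_permutation] rot
        permutes_orbit_subset[OF around_permutes that(1)]
      by (intro orbit_inverse) auto
    moreover have "h j \<in> h ` orbit around i \<longleftrightarrow> j \<in> orbit around i"
      using permutes_orbit_subset[OF around_permutes that(1)] that(2)
      by (intro inj_on_image_mem_iff[OF inj])
    ultimately show ?thesis
      using orbit_rot[OF arc[OF that(1)] arc[OF that(2)]] origin_eq_iff[OF that(1)] by simp
  qed
  \<comment> \<open>The chosen representative does not matter: \<open>tail_eq\<close> says that legs
    with the same origin have the same tail.\<close>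
  define f where "f v = (case v of Fold j \<Rightarrow> head (graph T) (h j)
      | Vertex X \<Rightarrow> tail (graph T) (h (SOME j. j \<in> {1..n} \<and> origin j = v)))" for v
  define g where "g a = (case a of Leg j \<Rightarrow> h j | Stub j \<Rightarrow> flip T (h j))" for a
  have f_Fold: "f (Fold j) = head (graph T) (h j)" for j by (simp add: f_def)
  have f_origin: "f (origin j) = tail (graph T) (h j)" if "j \<in> {1..n}" for j
  proof -
    have "(SOME i. i \<in> {1..n} \<and> origin i = origin j) \<in> {1..n} \<and>
        origin (SOME i. i \<in> {1..n} \<and> origin i = origin j) = origin j"
      by (rule someI[of _ j]) (use that in simp)
    then have "tail (graph T) (h (SOME i. i \<in> {1..n} \<and> origin i = origin j)) = tail (graph T) (h j)"
      using tail_eq that by blast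
    then show ?thesis by (simp add: f_def origin_def)
  qed
  have unmarked: "tail (graph T) (h j) \<notin> marked T" if "j \<in> {1..n}" for j
    using leg[OF that] by (simp add: legs_def)
  have Fold_inj: "i = j" if "i \<in> folded n \<tau>" "j \<in> folded n \<tau>" "head (graph T) (h i) = head (graph T) (h j)" for i j
  proof -
    have ij: "i \<in> {1..n}" "j \<in> {1..n}" using that by (simp_all add: folded_iff)
    have "flip T (h i) = flip T (h j)"
      by (rule marked_unique_arc) (use that arc[OF ij(1)] arc[OF ij(2)] fold[of i] in \<open>simp_all add: folded_iff\<close>)
    then have "h i = h j" by (simp only: arev_eq_iff)
    then show ?thesis using ij by (rule inj_onD[OF inj])
  qed
  \<comment> \<open>The reverse of such an arc is a leg by \<open>marked_neighbour\<close>. Its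
    label must be folded, for otherwise the arc itself would be a leg.\<close>
  have stub: "\<exists>j\<in>folded n \<tau>. b = flip T (h j)"
    if b: "b \<in> arcs (graph T)" "tail (graph T) b \<in> marked T" for b
  proof -
    have "flip T b \<in> legs" using marked_neighbour[OF ne b] b(1) by (simp add: legs_def)
    then obtain j where j: "j \<in> {1..n}" "flip T b = h j" using surj by blast
    then have bj: "b = flip T (h j)" by (metis arev_arev)
    have "\<tau> Red j = j"
    proof (rule ccontr)
      assume "\<tau> Red j \<noteq> j"
      then have "b = h (\<tau> Red j)" using flip[OF j(1)] bj by simp
      then show False using unmarked[of "\<tau> Red j"] b(2) j(1) in_iff by simp
    qed
    then show ?thesis using j(1) bj by (auto simp: folded_iff)
  qed
  have "bij_betw f (verts (graph ?S)) (verts (graph T))"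
  proof (rule bij_betw_imageI)
    show "inj_on f (verts (graph ?S))"
    proof (rule inj_onI)
      fix u v assume "u \<in> verts (graph ?S)" "v \<in> verts (graph ?S)" "f u = f v"
      moreover have "f (origin i) \<noteq> f (Fold j)" if "i \<in> {1..n}" "j \<in> folded n \<tau>" for i j
        using that unmarked[OF that(1)] fold[of j] f_Fold f_origin folded_iff by metis
      moreover have "f (Fold j) \<noteq> f (origin i)" if "i \<in> {1..n}" "j \<in> folded n \<tau>" for i j
        using calculation(4)[OF that] by simp
      ultimately show "u = v"
        using tail_eq Fold_inj
        by (auto simp: tree_of_simps f_Fold f_origin simp del: atLeastAtMost_iff)
    qed
    show "f ` verts (graph ?S) = verts (graph T)"
    proof (intro set_eqI iffI)
      fix v assume "v \<in> f ` verts (graph ?S)"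
      then show "v \<in> verts (graph T)"
        using arc by (auto simp: tree_of_simps f_Fold f_origin folded_iff simp del: atLeastAtMost_iff)
    next
      fix v assume "v \<in> verts (graph T)"
      then obtain a where a: "a \<in> arcs (graph T)" "tail (graph T) a = v" by (rule vertex_has_arc[OF ne])
      show "v \<in> f ` verts (graph ?S)"
      proof (cases "v \<in> marked T")
        case True
        then obtain j where j: "j \<in> folded n \<tau>" "a = flip T (h j)" using stub a by blast
        then have "v = f (Fold j)" using a arc[of j] by (simp add: f_Fold folded_iff)
        then show ?thesis using j(1) by (auto simp: tree_of_simps)
      next
        case False
        then have "a \<in> legs" using a by (simp add: legs_def)
        then obtain j where j: "j \<in> {1..n}" "a = h j" using surj by blast
        then have "v = f (origin j)" using a by (simp add: f_origin)
        then show ?thesis using j(1) by (simp add: tree_of_simps)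
      qed
    qed
  qed
  moreover have "bij_betw g (arcs (graph ?S)) (arcs (graph T))"
  proof (rule bij_betw_imageI)
    have "h i \<noteq> flip T (h j)" if "i \<in> {1..n}" "j \<in> folded n \<tau>" for i j
    proof
      assume eq: "h i = flip T (h j)"
      have "tail (graph T) (flip T (h j)) \<in> marked T"
        using fold[of j] arc[of j] that(2) by (simp add: folded_iff)
      then show False using unmarked[OF that(1)] eq by simp
    qed
    moreover have "i = j" if "i \<in> folded n \<tau>" "j \<in> folded n \<tau>" "flip T (h i) = flip T (h j)" for i j
      using that inj_onD[OF inj, of i j] by (simp add: arev_eq_iff folded_iff)
    ultimately show "inj_on g (arcs (graph ?S))"
      using inj_onD[OF inj]
      by (intro inj_onI)
         (auto simp: tree_of_simps g_def simp del: atLeastAtMost_iff dest: sym)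
    show "g ` arcs (graph ?S) = arcs (graph T)"
    proof (intro set_eqI iffI)
      fix a assume "a \<in> g ` arcs (graph ?S)"
      then show "a \<in> arcs (graph T)"
        using arc by (auto simp: tree_of_simps g_def folded_iff simp del: atLeastAtMost_iff)
    next
      fix a assume a: "a \<in> arcs (graph T)"
      show "a \<in> g ` arcs (graph ?S)"
      proof (cases "tail (graph T) a \<in> marked T")
        case True
        then obtain j where j: "j \<in> folded n \<tau>" "a = flip T (h j)" using stub a by blast
        then have "a = g (Stub j)" by (simp add: g_def)
        then show ?thesis using j(1) by (simp add: tree_of_simps)
      next
        case False
        then have "a \<in> legs" using a by (simp add: legs_def)
        then obtain j where j: "j \<in> {1..n}" "a = h j" using surj by blast
        then have "a = g (Leg j)" by (simp add: g_def)
        then show ?thesis using j(1) by (simp add: tree_of_simps)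
      qed
    qed
  qed
  moreover have "f ` marked ?S = marked T"
  proof (intro set_eqI iffI)
    fix v assume "v \<in> f ` marked ?S"
    then show "v \<in> marked T" using fold by (auto simp: tree_of_simps f_Fold folded_iff)
  next
    fix v assume v: "v \<in> marked T"
    then have "v \<in> verts (graph T)" using decorated by (auto simp: decorated_plane_tree_def)
    then obtain a where a: "a \<in> arcs (graph T)" "tail (graph T) a = v" by (rule vertex_has_arc[OF ne])
    then obtain j where j: "j \<in> folded n \<tau>" "a = flip T (h j)" using stub v by blast
    then have "v = f (Fold j)" using a arc[of j] by (simp add: f_Fold folded_iff)
    then show "v \<in> f ` marked ?S" using j(1) by (auto simp: tree_of_simps)
  qed
  moreover have "tail (graph T) (g a) = f (tail (graph ?S) a) \<and>
      head (graph T) (g a) = f (head (graph ?S) a) \<and>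
      flip T (g a) = g (flip ?S a) \<and> rot T (g a) = g (rot ?S a)" if a: "a \<in> arcs (graph ?S)" for a
  proof (cases a)
    case (Leg j)
    then have j: "j \<in> {1..n}" using a by (auto simp: tree_of_simps)
    have "head (graph T) (h j) = tail (graph T) (h (\<tau> Red j))" if "\<tau> Red j \<noteq> j"
      using tail_arev[OF arc[OF j]] flip[OF j that] by simp
    then show ?thesis
      using Leg j flip[OF j] rot[OF j] in_iff[of Red j]
      by (simp add: tree_of_simps g_def f_origin f_Fold del: atLeastAtMost_iff)
  next
    case (Stub j)
    then have j: "j \<in> folded n \<tau>" "j \<in> {1..n}" "\<tau> Red j = j" using a by (auto simp: tree_of_simps folded_iff)
    have s: "flip T (h j) \<in> arcs (graph T)" "tail (graph T) (flip T (h j)) \<in> marked T"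
      using arc[OF j(2)] fold[OF j(2,3)] by auto
    \<comment> \<open>A marked vertex has a single outgoing arc, so the rotation there is trivial,
      as it is on \<open>Stub j\<close>.\<close>
    have "rot T (flip T (h j)) = flip T (h j)"
      by (rule marked_unique_arc) (use s rot_in_arcs tail_rot in auto)
    then show ?thesis
      using Stub j arc[OF j(2)] by (simp add: tree_of_simps g_def f_origin f_Fold)
  qed
  ultimately show ?thesis unfolding tree_iso_def by blast
qed

end

section \<open>Fibres and shears\<close>

lemma involution_permutes:
  assumes "\<And>a. f (f a) = a" "\<And>a. a \<notin> S \<Longrightarrow> f a = a"
  shows "f permutes S"
  using assms unfolding permutes_def by metis

lemma labellingD:
  assumes "labelling n \<tau> T h" "j \<in> {1..n}"
  shows "rot T (h j) = h (\<tau> Red (\<tau> Green (\<tau> Blue j)))"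
    and "\<tau> Red j = j \<Longrightarrow> head (graph T) (h j) \<in> marked T"
    and "\<tau> Red j \<noteq> j \<Longrightarrow> flip T (h j) = h (\<tau> Red j)"
  using assms by (auto simp: labelling_def simp del: atLeastAtMost_iff split: if_splits)

context decorated_tree
begin

text \<open>Sorting legs by their unmarked tails gives the sum of the degrees; this is where the
  number of triangles comes from.\<close>

lemma card_legs:
  assumes "tree_profile T \<mu> l"
  shows "card legs = sum_mset \<mu>"
proof -
  let ?A = "verts (graph T) - marked T"
  have "legs = (\<Union>v\<in>?A. out_arcs (graph T) v)" by (auto simp: legs_def)
  also have "card \<dots> = (\<Sum>v\<in>?A. out_degree (graph T) v)"
    unfolding out_degree_def by (rule card_UN_disjoint) auto
  also have "\<dots> = sum_mset \<mu>"
    using assms by (simp add: tree_profile_iff sum_unfold_sum_mset)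
  finally show ?thesis .
qed

lemma ex_labelling:
  assumes n: "card legs = n" "n \<ge> 1"
  shows "\<exists>\<tau> h. cyclic_triple n \<tau> \<and> labelling n \<tau> T h"
proof -
  have cyc: "cyclic_on face legs" using n by (intro cyclic_on_face) auto
  obtain b where b: "b \<in> legs" using cyc by (auto simp: cyclic_on_def)
  have orbit: "orbit face b = legs" using cyc b by (rule orbit_cyclic_eq3)
  have self: "b \<in> orbit face b" using b orbit by simp
  have legs_eq: "legs = (\<lambda>i. (face ^^ i) b) ` {0..<funpow_dist1 face b b}"
    using orbit_conv_funpow_dist1[OF self] orbit by simp
  have inj0: "inj_on (\<lambda>i. (face ^^ i) b) {0..<funpow_dist1 face b b}"
    using self by (rule inj_on_funpow_dist1)
  have dist: "funpow_dist1 face b b = n"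
    using card_image[OF inj0] legs_eq n(1) by simp
  have period: "(face ^^ n) b = b" using funpow_dist1_prop[OF self] dist by simp
  \<comment> \<open>Legs are numbered from 1 along the face walk, so that \<open>face\<close>
    becomes \<open>j\<close> to \<open>j + 1\<close> modulo \<open>n\<close>.\<close>
  define h where "h j = (face ^^ (j - 1)) b" for j
  have "bij_betw (\<lambda>i. (face ^^ i) b) {0..<n} legs"
    using inj0 legs_eq dist by (simp add: bij_betw_def)
  moreover have "bij_betw (\<lambda>j. j - 1) {1..n} {0..<n}"
    by (rule bij_betwI[of _ _ _ Suc]) auto
  ultimately have bij: "bij_betw h {1..n} legs"
    using bij_betw_trans[of "\<lambda>j. j - 1" "{1..n}" "{0..<n}" "\<lambda>i. (face ^^ i) b" legs]
    by (simp add: h_def[abs_def] comp_def)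
  have inj: "inj_on h {1..n}" using bij by (rule bij_betw_imp_inj_on)
  define k where "k = inv_into {1..n} h"
  have k_h: "k (h j) = j" if "j \<in> {1..n}" for j
    using that inj by (simp add: k_def inv_into_f_f)
  have h_k: "h (k a) = a" and k_in: "k a \<in> {1..n}" if "a \<in> legs" for a
    using that bij_betw_imp_surj_on[OF bij] by (simp_all add: k_def f_inv_into_f inv_into_into del: atLeastAtMost_iff)
  have h_in: "h j \<in> legs" if "j \<in> {1..n}" for j
    using that bij_betw_imp_surj_on[OF bij] by blast
  \<comment> \<open>Green is \<open>j\<close> to \<open>n + 1 - j\<close> and blue is
    \<open>j\<close> to \<open>-j\<close>, both modulo \<open>n\<close>; their product is the shift
    by one. The residue 0 is represented by \<open>n\<close>, whence the exceptional value of blue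
    at \<open>n\<close>.\<close>
  define \<tau> where "\<tau> c = (\<lambda>j. if j \<in> {1..n} then
      (case c of Red \<Rightarrow> k (red (h j)) | Green \<Rightarrow> n + 1 - j | Blue \<Rightarrow> if j = n then n else n - j) else j)" for c
  have inv: "\<tau> c (\<tau> c j) = j" for c j
  proof (cases "j \<in> {1..n}")
    case True
    then show ?thesis
    proof (cases c)
      case Red
      have "k (red (h j)) \<in> {1..n}" "h (k (red (h j))) = red (h j)"
        using True by (simp_all add: h_k k_in h_in red_in_legs del: atLeastAtMost_iff)
      then show ?thesis using True Red by (simp add: \<tau>_def red_red k_h del: atLeastAtMost_iff)
    qed (auto simp: \<tau>_def)
  qed (auto simp: \<tau>_def)
  have perm: "\<tau> c permutes {1..n}" for c
    using inv by (rule involution_permutes) (simp add: \<tau>_def del: atLeastAtMost_iff)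
  have red: "h (\<tau> Red j) = red (h j)" if "j \<in> {1..n}" for j
    using that by (simp add: \<tau>_def h_k h_in red_in_legs del: atLeastAtMost_iff)
  have in_iff: "\<tau> c j \<in> {1..n} \<longleftrightarrow> j \<in> {1..n}" for c j
    using perm by (rule permutes_in_image)
  have face: "h (\<tau> Green (\<tau> Blue j)) = face (h j)" if j: "j \<in> {1..n}" for j
  proof (cases "j = n")
    case True
    then have "\<tau> Green (\<tau> Blue j) = 1" using n(2) by (simp add: \<tau>_def)
    moreover have "face (h n) = (face ^^ n) b"
      using n(2) by (cases n) (simp_all add: h_def)
    ultimately show ?thesis using True period by (simp add: h_def)
  next
    case False
    then have "\<tau> Green (\<tau> Blue j) = Suc j" using j by (auto simp: \<tau>_def)
    moreover have "face (h j) = (face ^^ j) b" using j by (cases j) (simp_all add: h_def)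
    ultimately show ?thesis by (simp add: h_def)
  qed
  have "cyclic_on (\<tau> Green \<circ> \<tau> Blue) (k ` legs)"
  proof (rule cyclic_on_image[OF cyc])
    fix a assume a: "a \<in> legs"
    then have "k (face a) = k (h (\<tau> Green (\<tau> Blue (k a))))" by (simp add: face k_in h_k del: atLeastAtMost_iff)
    also have "\<dots> = \<tau> Green (\<tau> Blue (k a))" using a by (intro k_h) (simp add: in_iff k_in del: atLeastAtMost_iff)
    finally show "(\<tau> Green \<circ> \<tau> Blue) (k a) = k (face a)" by simp
  qed
  moreover have "k ` legs = {1..n}"
    using bij_betw_inv_into[OF bij] by (simp add: k_def bij_betw_def)
  ultimately have "cyclic_triple n \<tau>"
    unfolding cyclic_triple_def using perm inv by (auto simp: fun_eq_iff)
  moreover have "labelling n \<tau> T h"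
    unfolding labelling_iff_legs
  proof (intro conjI ballI bij)
    fix j assume j: "j \<in> {1..n}"
    have "h (\<tau> Red (\<tau> Green (\<tau> Blue j))) = red (face (h j))"
      using j by (simp add: red face in_iff del: atLeastAtMost_iff)
    then show "rot T (h j) = h (\<tau> Red (\<tau> Green (\<tau> Blue j)))"
      using h_in[OF j] by (simp add: face_def red_red)
    have arc: "h j \<in> arcs (graph T)" using h_in[OF j] by (simp add: legs_def)
    show "if \<tau> Red j = j then head (graph T) (h j) \<in> marked T else flip T (h j) = h (\<tau> Red j)"
    proof (cases "head (graph T) (h j) \<in> marked T")
      case True
      then have "h (\<tau> Red j) = h j" using red[OF j] by (simp add: red_def)
      then have "\<tau> Red j = j" using inj_onD[OF inj] j in_iff by blast
      then show ?thesis using True by simp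
    next
      case False
      then have "h (\<tau> Red j) = flip T (h j)" using red[OF j] h_in[OF j] by (simp add: red_def)
      moreover from this have "\<tau> Red j \<noteq> j" using arev_neq[OF arc] by metis
      ultimately show ?thesis by simp
    qed
  qed
  ultimately show ?thesis by blast
qed

text \<open>The tree dictates red (fixed at legs into marked leaves, reversal elsewhere) and the
  full product; cancelling red leaves the green-blue cycle. How that cycle splits into two
  involutions is not visible in the tree, and this is the freedom explored by shears.\<close>

lemma labelling_unique:
  assumes "involution_triple n \<sigma>" "involution_triple n \<tau>"
    and \<sigma>: "labelling n \<sigma> T h" and \<tau>: "labelling n \<tau> T h"
  shows "\<sigma> Red = \<tau> Red" "\<sigma> Green \<circ> \<sigma> Blue = \<tau> Green \<circ> \<tau> Blue"
proof -
  interpret \<sigma>: involution_triple n \<sigma> by fact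
  interpret \<tau>: involution_triple n \<tau> by fact
  have bij: "bij_betw h {1..n} legs" using \<sigma> by (simp add: labelling_iff_legs)
  then have inj: "i = j" if "h i = h j" "i \<in> {1..n}" "j \<in> {1..n}" for i j
    using that by (meson bij_betw_imp_inj_on inj_onD)
  have leg: "h j \<in> legs" if "j \<in> {1..n}" for j using bij that by (meson bij_betwE)
  have fixed: "\<rho> Red j = j \<longleftrightarrow> head (graph T) (h j) \<in> marked T"
    if "involution_triple n \<rho>" "labelling n \<rho> T h" and j: "j \<in> {1..n}" for \<rho> j
  proof
    interpret \<rho>: involution_triple n \<rho> by fact
    show "\<rho> Red j = j" if "head (graph T) (h j) \<in> marked T"
    proof (rule ccontr)
      assume "\<rho> Red j \<noteq> j"
      then have "flip T (h j) = h (\<rho> Red j)"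
        by (rule labellingD(3)[OF \<open>labelling n \<rho> T h\<close> j])
      \<comment> \<open>A moved label would make the reversed arc a leg, although it leaves a marked
        leaf.\<close>
      then have "flip T (h j) \<in> legs" using leg[of "\<rho> Red j"] \<rho>.in_iff j by simp
      then show False using leg[OF j] that by (simp add: legs_def)
    qed
  qed (rule labellingD(2)[OF that(2,3)])
  have red: "\<sigma> Red j = \<tau> Red j" if j: "j \<in> {1..n}" for j
  proof (cases "head (graph T) (h j) \<in> marked T")
    case True
    then show ?thesis using fixed[OF assms(1) \<sigma> j] fixed[OF assms(2) \<tau> j] by simp
  next
    case False
    then have "flip T (h j) = h (\<sigma> Red j)" "flip T (h j) = h (\<tau> Red j)"
      using fixed[OF assms(1) \<sigma> j] fixed[OF assms(2) \<tau> j] labellingD(3)[OF \<sigma> j] labellingD(3)[OF \<tau> j]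
      by blast+
    then show ?thesis using j \<sigma>.in_iff \<tau>.in_iff by (intro inj) simp_all
  qed
  have around: "\<sigma> Red (\<sigma> Green (\<sigma> Blue j)) = \<tau> Red (\<tau> Green (\<tau> Blue j))" if j: "j \<in> {1..n}" for j
  proof (rule inj)
    show "h (\<sigma> Red (\<sigma> Green (\<sigma> Blue j))) = h (\<tau> Red (\<tau> Green (\<tau> Blue j)))"
      using labellingD(1)[OF \<sigma> j] labellingD(1)[OF \<tau> j] by simp
  qed (use j in \<open>simp_all only: \<sigma>.in_iff \<tau>.in_iff\<close>)
  have out: "\<sigma> c j = j" "\<tau> c j = j" if "j \<notin> {1..n}" for c j
    using that permutes_not_in[OF \<sigma>.permutes] permutes_not_in[OF \<tau>.permutes] by auto
  show Red: "\<sigma> Red = \<tau> Red"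
  proof
    show "\<sigma> Red j = \<tau> Red j" for j using red out by (cases "j \<in> {1..n}") auto
  qed
  show "\<sigma> Green \<circ> \<sigma> Blue = \<tau> Green \<circ> \<tau> Blue"
  proof
    fix j
    show "(\<sigma> Green \<circ> \<sigma> Blue) j = (\<tau> Green \<circ> \<tau> Blue) j"
    proof (cases "j \<in> {1..n}")
      case True
      then have "\<tau> Red (\<tau> Red (\<sigma> Green (\<sigma> Blue j))) = \<tau> Red (\<tau> Red (\<tau> Green (\<tau> Blue j)))"
        using around Red by metis
      then show ?thesis by (simp add: \<tau>.invol)
    qed (simp add: out)
  qed
qed

text \<open>Lets two surfaces with the same tree be relabelled until they share one labelling, as
  \<open>labelling_unique\<close> requires.\<close>

lemma labelling_conj:
  assumes "labelling n \<tau> T h" "\<pi> permutes {1..n}" "\<And>j. j \<in> {1..n} \<Longrightarrow> h j = h' (\<pi> j)"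
    and perm: "\<And>c. \<tau> c permutes {1..n}" and \<tau>': "\<And>c. \<tau>' c = \<pi> \<circ> \<tau> c \<circ> inv \<pi>"
  shows "labelling n \<tau>' T h'"
  unfolding labelling_iff_legs
proof (intro conjI ballI)
  have "bij_betw h {1..n} legs" using assms(1) by (simp add: labelling_iff_legs)
  then have "bij_betw (h' \<circ> \<pi>) {1..n} legs"
    by (rule bij_betw_cong[THEN iffD1, rotated]) (simp add: assms(3))
  then show "bij_betw h' {1..n} legs"
    using bij_betw_comp_iff[OF permutes_imp_bij[OF assms(2)], of h' legs] by simp
  have conj: "\<tau>' c (\<pi> j) = \<pi> (\<tau> c j)" for c j
    using assms(2) by (simp add: \<tau>' permutes_inverses)
  fix i assume "i \<in> {1..n}"
  then obtain j where j: "j \<in> {1..n}" "i = \<pi> j"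
    using permutes_image[OF assms(2)] by blast
  have in_iff: "\<tau> c a \<in> {1..n} \<longleftrightarrow> a \<in> {1..n}" for c a using perm by (rule permutes_in_image)
  note lab = labellingD[OF assms(1) j(1)]
  show "rot T (h' i) = h' (\<tau>' Red (\<tau>' Green (\<tau>' Blue i)))"
    using lab(1) j by (simp add: conj assms(3) in_iff del: atLeastAtMost_iff)
  have "\<tau>' Red i = i \<longleftrightarrow> \<tau> Red j = j"
    using j(2) inj_eq[OF permutes_inj[OF assms(2)]] by (simp add: conj)
  then show "if \<tau>' Red i = i then head (graph T) (h' i) \<in> marked T else flip T (h' i) = h' (\<tau>' Red i)"
    using lab(2,3) j by (simp add: conj assms(3) in_iff del: atLeastAtMost_iff)
qed

end

lemma shear_cyclic_triple:
  assumes "cyclic_triple n \<tau>"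
  shows "shear {1..n} x y \<tau> = \<tau>(x := \<tau> y, y := \<tau> y \<circ> \<tau> x \<circ> \<tau> y)"
proof -
  have "\<tau> c j = j" if "j \<notin> {1..n}" for c j
    using that permutes_not_in[OF cyclic_triple_permutes[OF assms]] by blast
  then have "(\<lambda>j. if j \<in> {1..n} then \<tau> y j else \<tau> x j) = \<tau> y"
    "(\<lambda>j. if j \<in> {1..n} then \<tau> y (\<tau> x (\<tau> y j)) else \<tau> y j) = \<tau> y \<circ> \<tau> x \<circ> \<tau> y"
    by (auto simp: fun_eq_iff simp del: atLeastAtMost_iff)
  then show ?thesis by (simp add: shear_def)
qed

text \<open>There is a single horizontal cylinder, covering all triangles, so only its two shears
  remain.\<close>

lemma horizontal_shear_iff:
  assumes "cyclic_triple n \<tau>" "n \<ge> 1"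
  shows "horizontal_shear n \<tau> \<tau>' \<longleftrightarrow>
    \<tau>' = \<tau>(Green := \<tau> Blue, Blue := \<tau> Blue \<circ> \<tau> Green \<circ> \<tau> Blue) \<or>
    \<tau>' = \<tau>(Blue := \<tau> Green, Green := \<tau> Green \<circ> \<tau> Blue \<circ> \<tau> Green)"
proof -
  have "component \<tau> {Green, Blue} j = {1..n}" if "j \<in> {1..n}" for j
    using that by (intro cyclic_triple_component[OF assms(1)]) auto
  moreover have "1 \<in> {1..n}" using assms(2) by simp
  ultimately show ?thesis
    unfolding horizontal_shear_def Let_def
    using shear_cyclic_triple[OF assms(1)] by (metis (no_types))
qed

text \<open>Writing G and B for the old involutions, the new products are B(BGB) and (GBG)G, both
  equal to GB.\<close>

lemma horizontal_shear_invariants: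
  assumes "cyclic_triple n \<tau>" "n \<ge> 1" "horizontal_shear n \<tau> \<tau>'"
  shows "cyclic_triple n \<tau>'" "\<tau>' Red = \<tau> Red" "\<tau>' Green \<circ> \<tau>' Blue = \<tau> Green \<circ> \<tau> Blue"
proof -
  have inv: "\<tau> c (\<tau> c a) = a" for c a using assms(1) by (rule cyclic_triple_invol)
  have perm: "\<tau> c permutes {1..n}" for c using assms(1) by (rule cyclic_triple_permutes)
  have cases: "\<tau>' = \<tau>(Green := \<tau> Blue, Blue := \<tau> Blue \<circ> \<tau> Green \<circ> \<tau> Blue) \<or>
    \<tau>' = \<tau>(Blue := \<tau> Green, Green := \<tau> Green \<circ> \<tau> Blue \<circ> \<tau> Green)"
    using assms by (simp add: horizontal_shear_iff)
  then show "\<tau>' Red = \<tau> Red" by auto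
  show GB: "\<tau>' Green \<circ> \<tau>' Blue = \<tau> Green \<circ> \<tau> Blue"
    using cases by (auto simp: fun_eq_iff inv)
  have "\<tau> x \<circ> \<tau> y \<circ> \<tau> x permutes {1..n}" for x y
    using perm by (intro permutes_compose)
  then have "\<tau>' c permutes {1..n}" for c using cases perm by auto
  moreover have "\<tau>' c \<circ> \<tau>' c = id" for c using cases by (auto simp: fun_eq_iff inv)
  ultimately have "\<tau>' c permutes {1..n} \<and> \<tau>' c \<circ> \<tau>' c = id" for c by blast
  then show "cyclic_triple n \<tau>'"
    using assms(1) GB by (simp add: cyclic_triple_def)
qed

lemma surface_iso_cyclic_triple:
  assumes "cyclic_triple n \<tau>" "surface_iso n \<tau> \<tau>'"
  shows "cyclic_triple n \<tau>'"
proof -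
  obtain \<pi> where \<pi>: "\<pi> permutes {1..n}" "\<And>c. \<tau>' c = \<pi> \<circ> \<tau> c \<circ> inv \<pi>"
    using assms(2) unfolding surface_iso_def by blast
  have "\<tau>' c permutes {1..n}" for c
    unfolding \<pi>(2) using \<pi>(1) cyclic_triple_permutes[OF assms(1)]
    by (intro permutes_compose permutes_inv)
  moreover have "\<tau>' c \<circ> \<tau>' c = id" for c
    using \<pi> by (simp add: fun_eq_iff permutes_inverses cyclic_triple_invol[OF assms(1)])
  moreover have "cyclic_on (\<tau>' Green \<circ> \<tau>' Blue) (\<pi> ` {1..n})"
    by (rule cyclic_on_image[of "\<tau> Green \<circ> \<tau> Blue"])
       (use assms(1) \<pi> in \<open>simp_all add: cyclic_triple_def permutes_inverses\<close>)
  ultimately show ?thesis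
    using permutes_image[OF \<pi>(1)] by (simp add: cyclic_triple_def)
qed

lemma surface_iso_sym:
  assumes "surface_iso n \<tau> \<tau>'" shows "surface_iso n \<tau>' \<tau>"
proof -
  obtain \<pi> where \<pi>: "\<pi> permutes {1..n}" "\<And>c. \<tau>' c = \<pi> \<circ> \<tau> c \<circ> inv \<pi>"
    using assms unfolding surface_iso_def by blast
  have "\<tau> c = inv \<pi> \<circ> \<tau>' c \<circ> inv (inv \<pi>)" for c
    using \<pi> by (simp add: fun_eq_iff permutes_inverses permutes_inv_inv)
  then show ?thesis unfolding surface_iso_def using permutes_inv[OF \<pi>(1)] by blast
qed

text \<open>The reflections compatible with the cycle \<open>c = \<tau> Green \<circ> \<tau> Blue\<close> are the powers of \<open>c\<close>
  times \<open>\<tau> Blue\<close>, and each shear multiplies by \<open>c\<close> once more.\<close>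

lemma shears_connect:
  assumes \<sigma>: "cyclic_triple n \<sigma>" and \<tau>: "cyclic_triple n \<tau>" and n: "n \<ge> 1"
    and red: "\<sigma> Red = \<tau> Red" and GB: "\<sigma> Green \<circ> \<sigma> Blue = \<tau> Green \<circ> \<tau> Blue"
  shows "(horizontal_shear n)\<^sup>*\<^sup>* \<sigma> \<tau>"
proof -
  define c where "c = \<tau> Green \<circ> \<tau> Blue"
  have orbit: "orbit c j = {1..n}" if "j \<in> {1..n}" for j
    using \<tau> that unfolding cyclic_triple_def c_def by (intro orbit_cyclic_eq3) simp_all
  have one: "1 \<in> {1..n}" using n by simp
  \<comment> \<open>The result of \<open>m\<close> shears that move green into blue, starting from
    \<open>\<sigma>\<close>. Shears in this one direction suffice, because on a finite cycle every
    power of \<open>c\<close> is a nonnegative one.\<close>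
  define \<rho> where "\<rho> m = \<sigma>(Green := c ^^ Suc m \<circ> \<sigma> Blue, Blue := c ^^ m \<circ> \<sigma> Blue)" for m
  have \<rho>: "cyclic_triple n (\<rho> m) \<and> \<rho> m Green \<circ> \<rho> m Blue = c \<and> (horizontal_shear n)\<^sup>*\<^sup>* \<sigma> (\<rho> m)" for m
  proof (induction m)
    case 0
    have "c \<circ> \<sigma> Blue = \<sigma> Green"
      unfolding c_def GB[symmetric] by (simp add: fun_eq_iff cyclic_triple_invol[OF \<sigma>])
    then have "\<rho> 0 = \<sigma>" by (simp add: \<rho>_def)
    then show ?case using \<sigma> GB by (simp add: c_def)
  next
    case (Suc m)
    have "\<rho> m Green \<circ> \<rho> m Blue \<circ> \<rho> m Green = c ^^ Suc (Suc m) \<circ> \<sigma> Blue"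
      using Suc by (metis \<rho>_def comp_assoc fun_upd_apply colour.distinct(5) funpow.simps(2))
    then have "\<rho> (Suc m) = (\<rho> m)(Blue := \<rho> m Green, Green := \<rho> m Green \<circ> \<rho> m Blue \<circ> \<rho> m Green)"
      by (simp add: \<rho>_def fun_upd_twist)
    then have "horizontal_shear n (\<rho> m) (\<rho> (Suc m))"
      using Suc horizontal_shear_iff[OF _ n, of "\<rho> m" "\<rho> (Suc m)"] by blast
    then show ?case
      using Suc horizontal_shear_invariants[OF _ n, of "\<rho> m" "\<rho> (Suc m)"]
      by (auto intro: rtranclp.rtrancl_into_rtrancl)
  qed
  \<comment> \<open>The cycle \<open>c\<close> is transitive, so some power of it corrects the value
    of blue at 1; this fixes the number of shears.\<close>
  have "\<tau> Blue 1 \<in> orbit c (\<sigma> Blue 1)"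
    using orbit[of "\<sigma> Blue 1"] one by (simp only: cyclic_triple_in[OF \<sigma>] cyclic_triple_in[OF \<tau>])
  then obtain m where m: "\<tau> Blue 1 = (c ^^ m) (\<sigma> Blue 1)" by (auto simp: orbit_altdef)
  \<comment> \<open>A blue involution compatible with \<open>c\<close> inverts it, so its value at
    \<open>a\<close> determines its value at \<open>c a\<close>. Agreement at 1 then propagates
    around the whole cycle.\<close>
  have c_Blue: "c (\<tau>' Blue (c a)) = \<tau>' Blue a"
    if "cyclic_triple n \<tau>'" "\<tau>' Green \<circ> \<tau>' Blue = c" for \<tau>' a
    using cyclic_triple_invol[OF that(1)] by (simp add: that(2)[symmetric])
  have inj: "a = b" if "c a = c b" for a b
    using that cyclic_triple_invol[OF \<tau>] unfolding c_def comp_apply by metis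
  have "\<tau> Blue j = \<rho> m Blue j" for j
  proof (cases "j \<in> {1..n}")
    case True
    have step: "\<tau> Blue (c a) = \<rho> m Blue (c a)" if "\<tau> Blue a = \<rho> m Blue a" for a
    proof (rule inj)
      show "c (\<tau> Blue (c a)) = c (\<rho> m Blue (c a))"
        using \<rho>[of m] by (simp only: c_Blue[OF \<tau> c_def[symmetric]] c_Blue that)
    qed
    have start: "\<tau> Blue 1 = \<rho> m Blue 1" using m by (simp add: \<rho>_def)
    have "j \<in> orbit c 1" using True orbit[OF one] by simp
    then show ?thesis
      by induction (rule step, fact start, rule step)
  next
    case False
    then show ?thesis
      using permutes_not_in[OF cyclic_triple_permutes[OF \<tau>] False]
        permutes_not_in[OF cyclic_triple_permutes False, of "\<rho> m"] \<rho>[of m] by simp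
  qed
  then have Blue: "\<tau> Blue = \<rho> m Blue" by blast
  moreover have "\<tau> Green a = \<rho> m Green a" for a
  proof -
    have "\<tau> Green a = c (\<tau> Blue a)" by (simp add: c_def cyclic_triple_invol[OF \<tau>])
    also have "\<dots> = \<rho> m Green a"
      using \<rho>[of m] Blue cyclic_triple_invol[of n "\<rho> m"] by (metis comp_apply)
    finally show ?thesis .
  qed
  moreover have "\<tau> Red = \<rho> m Red" using red by (simp add: \<rho>_def)
  ultimately have "\<tau> x = \<rho> m x" for x by (cases x) auto
  then show ?thesis using \<rho>[of m] by (metis ext)
qed

context decorated_tree
begin

text \<open>A shear keeps red and the green-blue product, so the same \<open>h\<close> still works;
  an isomorphism precomposes \<open>h\<close> with a relabelling.\<close>

lemma shear_orbit_invariant: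
  assumes "\<tau> \<in> shear_orbit n \<sigma>" "cyclic_triple n \<sigma>" "labelling n \<sigma> T h" "n \<ge> 1"
  shows "cyclic_triple n \<tau> \<and> (\<exists>h. labelling n \<tau> T h)"
proof -
  have "(\<lambda>a b. surface_iso n a b \<or> horizontal_shear n a b)\<^sup>*\<^sup>* \<sigma> \<tau>"
    using assms(1) by (simp add: shear_orbit_def)
  then show ?thesis
  proof induction
    case base
    then show ?case using assms by blast
  next
    case (step \<tau> \<tau>')
    then obtain h where cyc: "cyclic_triple n \<tau>" and h: "labelling n \<tau> T h" by blast
    show ?case
    proof (cases "surface_iso n \<tau> \<tau>'")
      case True
      then obtain \<pi> where \<pi>: "\<pi> permutes {1..n}" "\<And>c. \<tau>' c = \<pi> \<circ> \<tau> c \<circ> inv \<pi>"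
        unfolding surface_iso_def by blast
      have "labelling n \<tau>' T (h \<circ> inv \<pi>)"
        by (rule labelling_conj[OF h \<pi>(1) _ cyclic_triple_permutes[OF cyc] \<pi>(2)])
           (simp add: permutes_inverses[OF \<pi>(1)])
      then show ?thesis using surface_iso_cyclic_triple[OF cyc True] by blast
    next
      case False
      then have "horizontal_shear n \<tau> \<tau>'" using step by blast
      note inv = horizontal_shear_invariants[OF cyc assms(4) this]
      then have "labelling n \<tau>' T h"
        using h by (simp add: labelling_def fun_eq_iff)
      then show ?thesis using inv by blast
    qed
  qed
qed

text \<open>One isomorphism makes the labellings coincide; after that the triples share red and the
  green-blue cycle and are joined by shears alone.\<close>

lemma labelling_in_shear_orbit:
  assumes \<sigma>: "cyclic_triple n \<sigma>" "labelling n \<sigma> T g"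
    and \<tau>: "cyclic_triple n \<tau>" "labelling n \<tau> T h" and n: "n \<ge> 1"
  shows "\<tau> \<in> shear_orbit n \<sigma>"
proof -
  have bij: "bij_betw g {1..n} legs" "bij_betw h {1..n} legs"
    using \<sigma>(2) \<tau>(2) by (simp_all add: labelling_iff_legs)
  \<comment> \<open>Sends the label of a leg under \<open>g\<close> to its label under
    \<open>h\<close>.\<close>
  define \<pi> where "\<pi> j = (if j \<in> {1..n} then inv_into {1..n} h (g j) else j)" for j
  have "bij_betw (inv_into {1..n} h \<circ> g) {1..n} {1..n}"
    using bij(1) bij_betw_inv_into[OF bij(2)] by (rule bij_betw_trans)
  then have "bij_betw \<pi> {1..n} {1..n}"
    by (rule bij_betw_cong[THEN iffD1, rotated]) (simp add: \<pi>_def)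
  then have \<pi>: "\<pi> permutes {1..n}"
    by (rule bij_imp_permutes) (simp add: \<pi>_def del: atLeastAtMost_iff)
  have h_\<pi>: "g j = h (\<pi> j)" if "j \<in> {1..n}" for j
  proof -
    have "g j \<in> h ` {1..n}" using that bij by (metis bij_betwE bij_betw_imp_surj_on)
    then show ?thesis using that by (simp add: \<pi>_def f_inv_into_f del: atLeastAtMost_iff)
  qed
  define \<tau>' where "\<tau>' c = \<pi> \<circ> \<sigma> c \<circ> inv \<pi>" for c
  have iso: "surface_iso n \<sigma> \<tau>'" unfolding surface_iso_def \<tau>'_def using \<pi> by blast
  have cyc: "cyclic_triple n \<tau>'" using \<sigma>(1) iso by (rule surface_iso_cyclic_triple)
  have "labelling n \<tau>' T h"
    by (rule labelling_conj[OF \<sigma>(2) \<pi> h_\<pi> cyclic_triple_permutes[OF \<sigma>(1)] \<tau>'_def])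
  then have "(horizontal_shear n)\<^sup>*\<^sup>* \<tau>' \<tau>"
    using cyclic_triple_involution[OF cyc] cyclic_triple_involution[OF \<tau>(1)] \<tau>(2)
    by (intro shears_connect[OF cyc \<tau>(1) n] labelling_unique)
  then have "(\<lambda>a b. surface_iso n a b \<or> horizontal_shear n a b)\<^sup>*\<^sup>* \<tau>' \<tau>"
    by (rule rtranclp_mono[THEN predicate2D, rotated]) blast
  then show ?thesis
    unfolding shear_orbit_def using iso by (auto intro: converse_rtranclp_into_rtranclp)
qed

lemma labelling_imp_path_like_surface:
  assumes "cyclic_triple n \<tau>" "labelling n \<tau> T h" "n \<ge> 1" "k \<ge> 2" "tree_profile T \<mu> (k - 2)"
  shows "\<tau> \<in> path_like_surfaces n \<mu> k" "tree_iso (tree_of n \<tau>) T"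
proof -
  interpret involution_triple n \<tau> using assms(1) by (rule cyclic_triple_involution)
  show iso: "tree_iso (tree_of n \<tau>) T"
    using involution_triple_axioms assms(2,3) by (rule labelling_imp_tree_iso)
  have "tree_profile (tree_of n \<tau>) \<mu> (k - 2)"
    using tree_iso_tree_profile[OF iso tree.wf_digraph wf_digraph marked_tree_of] assms(5) by simp
  then show "\<tau> \<in> path_like_surfaces n \<mu> k"
    using assms by (simp add: path_like_surfaces_iff tree_profile_tree_of)
qed

end

lemma tree_iso_refl: "tree_iso T T"
  unfolding tree_iso_def by (intro exI[of _ id]) auto

theorem theorem3p2:
  fixes \<mu> :: "nat multiset" and n k :: nat
  assumes partition: "0 \<notin># \<mu>" "sum_mset \<mu> = n" "n \<ge> 1"
    and spherical: "(\<Sum>i\<in>set_mset \<mu>. int (count \<mu> i) * (int i - 2)) = int k - 4"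
    and k: "k \<ge> 2"
  shows "(\<forall>\<tau>\<in>path_like_surfaces n \<mu> k.
            decorated_plane_tree (tree_of n \<tau>) \<and> tree_profile (tree_of n \<tau>) \<mu> (k - 2)) \<and>
         (\<forall>\<tau>\<in>path_like_surfaces n \<mu> k. \<forall>\<tau>'\<in>path_like_surfaces n \<mu> k.
            surface_iso n \<tau> \<tau>' \<longrightarrow> tree_iso (tree_of n \<tau>) (tree_of n \<tau>')) \<and>
         (\<forall>T :: ('v, 'a) decorated_map.
            decorated_plane_tree T \<and> tree_profile T \<mu> (k - 2) \<longrightarrow>
            (\<exists>\<tau>\<in>path_like_surfaces n \<mu> k. tree_iso (tree_of n \<tau>) T)) \<and>
         (\<forall>T :: ('v, 'a) decorated_map.
            decorated_plane_tree T \<and> tree_profile T \<mu> (k - 2) \<longrightarrow>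
            (\<exists>\<tau>\<^sub>0\<in>path_like_surfaces n \<mu> k.
               {\<tau> \<in> path_like_surfaces n \<mu> k. tree_iso (tree_of n \<tau>) T} = shear_orbit n \<tau>\<^sub>0))"
proof (intro conjI ballI allI impI)
  have surface: "cyclic_triple n \<tau> \<and> tree_profile (tree_of n \<tau>) \<mu> (k - 2)"
    if "\<tau> \<in> path_like_surfaces n \<mu> k" for \<tau>
    using that cyclic_triple_involution[of n \<tau>] involution_triple.tree_profile_tree_of[of n \<tau>]
    by (simp add: path_like_surfaces_iff[OF partition(3) k])
  have tree: "decorated_plane_tree (tree_of n \<tau>)" if "\<tau> \<in> path_like_surfaces n \<mu> k" for \<tau>
    using surface[OF that] partition k spherical by (intro decorated_plane_tree_tree_of) auto
  show "decorated_plane_tree (tree_of n \<tau>)" "tree_profile (tree_of n \<tau>) \<mu> (k - 2)"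
    if "\<tau> \<in> path_like_surfaces n \<mu> k" for \<tau>
    using that surface tree by blast+
  show "tree_iso (tree_of n \<tau>) (tree_of n \<tau>')"
    if "\<tau> \<in> path_like_surfaces n \<mu> k" "\<tau>' \<in> path_like_surfaces n \<mu> k" "surface_iso n \<tau> \<tau>'" for \<tau> \<tau>'
  proof -
    interpret decorated_tree "tree_of n \<tau>'" using tree[OF that(2)] by unfold_locales
    have cyc: "cyclic_triple n \<tau>" "cyclic_triple n \<tau>'" using surface that by blast+
    obtain h where "labelling n \<tau>' (tree_of n \<tau>') h"
      using involution_triple.tree_iso_imp_labelling[OF cyclic_triple_involution[OF cyc(2)] tree_iso_refl]
      by blast
    \<comment> \<open>An isomorphism is a special case of the orbit relation, so the labelling of
      the tree of \<open>\<tau>'\<close> by \<open>\<tau>'\<close> itself yields one by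
      \<open>\<tau>\<close>.\<close>
    moreover have "\<tau> \<in> shear_orbit n \<tau>'"
      using surface_iso_sym[OF that(3)] by (auto simp: shear_orbit_def)
    ultimately obtain h where "labelling n \<tau> (tree_of n \<tau>') h"
      using shear_orbit_invariant cyc(2) partition(3) by blast
    then show ?thesis
      using cyclic_triple_involution[OF cyc(1)] partition(3) by (intro labelling_imp_tree_iso)
  qed
  fix T :: "('v, 'a) decorated_map"
  assume T: "decorated_plane_tree T \<and> tree_profile T \<mu> (k - 2)"
  interpret decorated_tree T using T by unfold_locales simp
  obtain \<sigma> g where \<sigma>: "cyclic_triple n \<sigma>" "labelling n \<sigma> T g"
    using ex_labelling[of n] card_legs T partition by blast
  note \<sigma>_surface = labelling_imp_path_like_surface[OF \<sigma> partition(3) k]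
  then show "\<exists>\<tau>\<in>path_like_surfaces n \<mu> k. tree_iso (tree_of n \<tau>) T"
    using T by blast
  \<comment> \<open>Both sides consist of the cyclic triples that label \<open>T\<close>: shears and
    isomorphisms preserve this property, and any two such triples are connected by them.\<close>
  have "{\<tau> \<in> path_like_surfaces n \<mu> k. tree_iso (tree_of n \<tau>) T} = shear_orbit n \<sigma>"
  proof (intro set_eqI iffI)
    fix \<tau> assume \<tau>: "\<tau> \<in> {\<tau> \<in> path_like_surfaces n \<mu> k. tree_iso (tree_of n \<tau>) T}"
    then have cyc: "cyclic_triple n \<tau>" using surface by blast
    obtain h where "labelling n \<tau> T h"
      using involution_triple.tree_iso_imp_labelling[OF cyclic_triple_involution[OF cyc]] \<tau> by blast
    then show "\<tau> \<in> shear_orbit n \<sigma>"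
      using \<sigma> cyc partition(3) labelling_in_shear_orbit by blast
  next
    fix \<tau> assume "\<tau> \<in> shear_orbit n \<sigma>"
    then obtain h where "cyclic_triple n \<tau>" "labelling n \<tau> T h"
      using shear_orbit_invariant[OF _ \<sigma> partition(3)] by blast
    then show "\<tau> \<in> {\<tau> \<in> path_like_surfaces n \<mu> k. tree_iso (tree_of n \<tau>) T}"
      using labelling_imp_path_like_surface[OF _ _ partition(3) k] T by blast
  qed
  then show "\<exists>\<tau>\<^sub>0\<in>path_like_surfaces n \<mu> k.
      {\<tau> \<in> path_like_surfaces n \<mu> k. tree_iso (tree_of n \<tau>) T} = shear_orbit n \<tau>\<^sub>0"
    using \<sigma>_surface(1) T by blast
qed

end
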